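(* Let $H$ be a real Hilbert space, and let $A$ be a self-adjoint operator on $H$ with domain $D(A)$ such that there exist an orthonormal basis $\{e_i\}_{i\ge 1}$ of $H$ and a nondecreasing sequence $\{\lambda_i\}_{i\ge 1}$ of positive real numbers with $\lambda_i\to+\infty$ and $Ae_i=\lambda_i^2e_i$ for every $i\ge 1$. Let $(u_0,u_1)\in\mathcal{SG}(A)$ be a pair of lacunary initial data. Let $m:[0,+\infty)\to[0,+\infty)$ be a function of class $C^1$ such that $$\inf\{m(\sigma):\sigma\ge 0\}>0.$$ Then the problem $$u''(t)+m\left(|A^{1/2}u(t)|^2\right)Au(t)=0,\qquad u(0)=u_0,\quad u'(0)=u_1,$$ admits at least one global weak solution $u$, and this solution satisfies the energy equality $$|u'(t)|^2+M\left(|A^{1/2}u(t)|^2\right)=|u_1|^2+M\left(|A^{1/2}u_0|^2\right)\qquad\text{for every }t\ge 0,$$ where $M(\sigma):=\int_0^\sigma m(s)\,ds$ for every $\sigma\ge 0$.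
   Context: Here $|\cdot|$ and $\langle\cdot,\cdot\rangle$ denote the norm and scalar product of $H$. The space $D(A^{1/2})$ is the set of all $v\in H$ with $\sum_{i\ge1}\lambda_i^2\langle v,e_i\rangle^2<+\infty$, with $A^{1/2}v:=\sum_{i\ge 1}\lambda_i\langle v,e_i\rangle e_i$, and it is endowed with its natural norm (for example $|A^{1/2}v|$, which is equivalent to the graph norm because $\lambda_1>0$). Lacunary data: for every $(u_0,u_1)\in D(A^{1/2})\times H$ and every positive integer $k$, set $$R_k(u_0,u_1):=\sum_{i=k+1}^{\infty}\left(\langle u_1,e_i\rangle^2+\lambda_i^2\langle u_0,e_i\rangle^2\right).$$ $\mathcal{SG}(A)$ denotes the set of all pairs $(u_0,u_1)\in D(A^{1/2})\times H$ such that $$R_k(u_0,u_1)\cdot k^2\exp(k\lambda_k)\le 1\qquad\text{for infinitely many integers }k\ge 1$$ (the set of such $k$ may depend on $(u_0,u_1)$). Global weak solution: a global weak solution to the problem $u''(t)+m(|A^{1/2}u(t)|^2)Au(t)=0$, $u(0)=u_0$, $u'(0)=u_1$, is any function $$u\in C^0\left([0,+\infty),D(A^{1/2})\right)\cap C^1\left([0,+\infty),H\right)$$ that satisfies $u(0)=u_0$, $u'(0)=u_1$, and in addition $$\int_0^T\langle u'(t),\varphi'(t)\rangle\,dt=\int_0^T m\left(|A^{1/2}u(t)|^2\right)\langle A^{1/2}u(t),A^{1/2}\varphi(t)\rangle\,dt$$ for every $T>0$ and every test function $\varphi\in C^0\left([0,T],D(A^{1/2})\right)\cap C^1\left([0,T],H\right)$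 such that $\varphi(0)=\varphi(T)=0$. *)

theory Defs
  imports "HOL-Analysis.Analysis"
begin

text \<open>
  Sequences indexed by the positive integers are functions on \<^typ>\<open>nat\<close> whose value at 0 is
  never used; series over \<open>i \<ge> 1\<close> are written with \<open>Suc i\<close>.
\<close>

definition orthonormal_basis :: "(nat \<Rightarrow> 'a::real_inner) \<Rightarrow> bool" where
  "orthonormal_basis e \<longleftrightarrow>
     (\<forall>i\<ge>1. \<forall>j\<ge>1. e i \<bullet> e j = (if i = j then 1 else 0)) \<and>
     closure (span (e ` {1..})) = UNIV"

text \<open>
  An unbounded operator is a pair of a domain \<open>D\<close> and a function \<open>A\<close> that is only relevant on \<open>D\<close>.
  The last conjunct says that the graph of the adjoint of \<open>A\<close> coincides with the graph of \<open>A\<close>;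
  in particular the domain of the adjoint is exactly \<open>D\<close>.
\<close>

definition self_adjoint_operator :: "'a::real_inner set \<Rightarrow> ('a \<Rightarrow> 'a) \<Rightarrow> bool" where
  "self_adjoint_operator D A \<longleftrightarrow>
     subspace D \<and> closure D = UNIV \<and>
     (\<forall>x\<in>D. \<forall>y\<in>D. A (x + y) = A x + A y) \<and>
     (\<forall>c. \<forall>x\<in>D. A (c *\<^sub>R x) = c *\<^sub>R A x) \<and>
     (\<forall>y z. (\<forall>x\<in>D. A x \<bullet> y = x \<bullet> z) \<longleftrightarrow> y \<in> D \<and> z = A y)"

definition dom_half :: "(nat \<Rightarrow> 'a::real_inner) \<Rightarrow> (nat \<Rightarrow> real) \<Rightarrow> 'a set" where
  "dom_half e lam = {v. summable (\<lambda>i. (lam (Suc i))\<^sup>2 * (v \<bullet> e (Suc i))\<^sup>2)}"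

definition A_half :: "(nat \<Rightarrow> 'a::real_inner) \<Rightarrow> (nat \<Rightarrow> real) \<Rightarrow> 'a \<Rightarrow> 'a" where
  "A_half e lam v = (\<Sum>i. (lam (Suc i) * (v \<bullet> e (Suc i))) *\<^sub>R e (Suc i))"

definition lacunary_remainder ::
    "(nat \<Rightarrow> 'a::real_inner) \<Rightarrow> (nat \<Rightarrow> real) \<Rightarrow> 'a \<Rightarrow> 'a \<Rightarrow> nat \<Rightarrow> real" where
  "lacunary_remainder e lam u0 u1 k =
     (\<Sum>j. (u1 \<bullet> e (k + 1 + j))\<^sup>2 + (lam (k + 1 + j))\<^sup>2 * (u0 \<bullet> e (k + 1 + j))\<^sup>2)"

definition SG :: "(nat \<Rightarrow> 'a::real_inner) \<Rightarrow> (nat \<Rightarrow> real) \<Rightarrow> ('a \<times> 'a) set" where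
  "SG e lam = {(u0, u1). u0 \<in> dom_half e lam \<and>
     infinite {k. k \<ge> 1 \<and>
       lacunary_remainder e lam u0 u1 k * ((real k)\<^sup>2 * exp (real k * lam k)) \<le> 1}}"

text \<open>Continuity on \<open>S\<close> with values in the domain of the square root, normed by \<open>\<bar>A\<^sup>1\<^sup>/\<^sup>2 v\<bar>\<close>.\<close>

definition C0_dom_half ::
    "(nat \<Rightarrow> 'a::real_inner) \<Rightarrow> (nat \<Rightarrow> real) \<Rightarrow> real set \<Rightarrow> (real \<Rightarrow> 'a) \<Rightarrow> bool" where
  "C0_dom_half e lam S u \<longleftrightarrow>
     (\<forall>t\<in>S. u t \<in> dom_half e lam) \<and>
     (\<forall>t\<in>S. ((\<lambda>s. norm (A_half e lam (u s - u t))) \<longlongrightarrow> 0) (at t within S))"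

text \<open>
  Class \<open>C\<^sup>1\<close> on an interval \<open>S\<close>, with one-sided derivatives at endpoints belonging to \<open>S\<close>
  (unlike the library's \<open>C1_differentiable_on\<close>, which asks for two-sided derivatives).
\<close>

definition C1_on :: "real set \<Rightarrow> (real \<Rightarrow> 'b::real_normed_vector) \<Rightarrow> bool" where
  "C1_on S u \<longleftrightarrow>
     (\<exists>u'. (\<forall>t\<in>S. (u has_vector_derivative u' t) (at t within S)) \<and> continuous_on S u')"

definition global_weak_solution ::
    "(nat \<Rightarrow> 'a::real_inner) \<Rightarrow> (nat \<Rightarrow> real) \<Rightarrow> (real \<Rightarrow> real) \<Rightarrow> 'a \<Rightarrow> 'a \<Rightarrow> (real \<Rightarrow> 'a) \<Rightarrow> bool" where
  "global_weak_solution e lam m u0 u1 u \<longleftrightarrow>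
     C0_dom_half e lam {0..} u \<and> C1_on {0..} u \<and>
     u 0 = u0 \<and> vector_derivative u (at 0 within {0..}) = u1 \<and>
     (\<forall>T>0. \<forall>\<phi>. C0_dom_half e lam {0..T} \<phi> \<and> C1_on {0..T} \<phi> \<and> \<phi> 0 = 0 \<and> \<phi> T = 0 \<longrightarrow>
        integral {0..T} (\<lambda>t. vector_derivative u (at t within {0..}) \<bullet>
                              vector_derivative \<phi> (at t within {0..T})) =
        integral {0..T} (\<lambda>t. m ((norm (A_half e lam (u t)))\<^sup>2) *
                              (A_half e lam (u t) \<bullet> A_half e lam (\<phi> t))))"

end

theory Submission
  imports Defs "HOL-Complex_Analysis.Great_Picard"
begin

text \<open>
  Why the theorem holds.  In the basis of eigenvectors the equation is the system
  \<open>y\<^sub>i'' = - \<lambda>\<^sub>i\<^sup>2 m(Q) y\<^sub>i\<close> with \<open>Q = \<Sum>\<^sub>i \<lambda>\<^sub>i\<^sup>2 y\<^sub>i\<^sup>2\<close>, and its energy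
  \<open>\<Sum>\<^sub>i y\<^sub>i'\<^sup>2 + M(Q)\<close> is conserved.  Truncation to \<open>N\<close> modes gives an ordinary differential
  equation with the same structure, and conservation of energy bounds its solutions uniformly in \<open>N\<close>
  (\<open>galerkin.energy_bounds\<close>).  By compactness a subsequence converges mode by mode.  The danger is that
  energy escapes to infinitely high modes, so that \<open>m(Q)\<close> does not converge.

  Lacunarity excludes this.  Split \<open>Q = Q\<^sub>k + h\<close> into the modes below \<open>k\<close> and the rest, and consider the
  energy of the tail, \<open>F = \<Sum>\<^sub>i\<^sub>\<ge>\<^sub>k y\<^sub>i'\<^sup>2 + M(Q) - M(Q\<^sub>k)\<close>.  All forces inside the tail cancel in the
  derivative, and \<open>F' = (m(Q) - m(Q\<^sub>k)) Q\<^sub>k'\<close>.  The first factor is at most a constant times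
  \<open>h \<le> F / \<mu>\<close>, where \<open>\<mu>\<close> is the lower bound of \<open>m\<close>, and the second one at most a constant times the
  largest frequency \<open>\<lambda>\<close> among the low modes.  Hence \<open>F(t) \<le> F(0) exp (c \<lambda> t)\<close>, with \<open>c\<close> independent
  of \<open>k\<close> and \<open>N\<close> (\<open>galerkin.tail_energy_growth\<close>).  For the infinitely many \<open>k\<close> in the definition of
  the lacunary data, \<open>F(0)\<close> is at most a constant times \<open>exp (- k \<lambda>) / k\<^sup>2\<close>, which beats the growth on
  every time interval \<open>[0, T]\<close> as soon as \<open>k \<ge> c T\<close>.  The tails are therefore small uniformly in time
  and in \<open>N\<close> (\<open>galerkin_tails\<close>).

  Consequently \<open>Q\<close>, the modes and the energy pass to the limit (\<open>global_modes_exist\<close>), the series of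
  modes converge uniformly on bounded time intervals to continuous functions with values in the energy
  space, and testing the equation of each mode and summing yields the weak equation
  (\<open>mode_solution.weak_equation\<close>).

  The nonlinearity is first frozen beyond a level \<open>S\<close>, which makes the truncated systems globally
  Lipschitz.  As energy is conserved and \<open>m \<ge> \<mu>\<close>, the argument \<open>Q\<close> never exceeds a level determined by
  the data; with \<open>S\<close> chosen above this level the solution solves the original problem.
\<close>

section \<open>Calculus on the half-line\<close>

lemma integral_has_vector_derivative_halfline:
  fixes f :: "real \<Rightarrow> 'b::banach"
  assumes "continuous_on {0..} f" "0 \<le> t"
  shows "((\<lambda>s. integral {0..s} f) has_vector_derivative f t) (at t within {0..})"
proof -
  have "((\<lambda>s. integral {0..s} f) has_vector_derivative f t) (at t within {0..t+1})"
    by (rule integral_has_vector_derivative) (auto intro: continuous_on_subset[OF assms(1)] simp: assms(2))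
  moreover have "at t within {0..t+1} = at t within {0..}"
    by (rule at_within_nhd[of _ "{t-1<..<t+1}"]) auto
  ultimately show ?thesis by simp
qed

lemma continuous_on_halflineI:
  fixes f :: "real \<Rightarrow> 'b::topological_space"
  assumes "\<And>T. continuous_on {0..T} f"
  shows "continuous_on {0..} f"
proof -
  have "continuous (at t within {0..}) f" if "0 \<le> t" for t
  proof -
    have "continuous (at t within {0..t+1}) f"
      using assms[of "t+1"] that by (simp add: continuous_on_eq_continuous_within)
    moreover have "at t within {0..t+1} = at t within {0..}"
      by (rule at_within_nhd[of _ "{t-1<..<t+1}"]) auto
    ultimately show ?thesis by (simp add: continuous_within)
  qed
  then show ?thesis by (simp add: continuous_on_eq_continuous_within)
qed

lemma has_integral_of_deriv_halfline:
  fixes f :: "real \<Rightarrow> 'b::banach"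
  assumes "\<And>t. 0 \<le> t \<Longrightarrow> (f has_vector_derivative f' t) (at t within {0..})" "0 \<le> t"
  shows "(f' has_integral (f t - f 0)) {0..t}"
  by (rule fundamental_theorem_of_calculus)
     (auto intro: has_vector_derivative_within_subset[OF assms(1)] assms(2))

text \<open>The function \<open>f t exp (- c t)\<close> is nonincreasing.\<close>

lemma gronwall_halfline:
  fixes f :: "real \<Rightarrow> real"
  assumes f': "\<And>t. 0 \<le> t \<Longrightarrow> (f has_real_derivative f' t) (at t within {0..})"
    and le: "\<And>t. 0 \<le> t \<Longrightarrow> f' t \<le> c * f t"
    and t: "0 \<le> t"
  shows "f t \<le> f 0 * exp (c * t)"
proof -
  define g where "g = (\<lambda>s. f s * exp (- c * s))"
  have g': "(g has_real_derivative (f' s - c * f s) * exp (- c * s)) (at s within {0..})"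
    if "0 \<le> s" for s
    unfolding g_def by (auto intro!: derivative_eq_intros f'[OF that] simp: algebra_simps)
  have "g t \<le> g 0"
  proof (rule DERIV_nonpos_imp_decreasing_open[OF t])
    fix s assume s: "0 < s" "s < t"
    have "at s within {0..} = at s" using s by (intro at_within_interior) auto
    with g'[of s] s le[of s]
    show "\<exists>y. (g has_real_derivative y) (at s) \<and> y \<le> 0"
      by (intro exI[of _ "(f' s - c * f s) * exp (- c * s)"]) (auto intro: mult_nonpos_nonneg)
  next
    have "continuous_on {0..} g"
      by (rule DERIV_continuous_on[OF g']) simp
    then show "continuous_on {0..t} g" by (rule continuous_on_subset) auto
  qed
  then have "f t * exp (- c * t) * exp (c * t) \<le> f 0 * exp (c * t)"
    by (intro mult_right_mono) (auto simp: g_def)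
  then show ?thesis by (simp add: mult.assoc flip: exp_add)
qed

lemma constant_halfline:
  fixes f :: "real \<Rightarrow> real"
  assumes "\<And>t. 0 \<le> t \<Longrightarrow> (f has_real_derivative 0) (at t within {0..})" "0 \<le> t"
  shows "f t = f 0"
  using has_integral_of_deriv_halfline[of f "\<lambda>_. 0" t] assms has_integral_0_eq
  by (auto simp: has_real_derivative_iff_has_vector_derivative)

lemma lipschitz_halfline:
  fixes f :: "real \<Rightarrow> real"
  assumes "\<And>t. 0 \<le> t \<Longrightarrow> (f has_real_derivative f' t) (at t within {0..})"
    and "\<And>t. 0 \<le> t \<Longrightarrow> \<bar>f' t\<bar> \<le> C" "0 \<le> s" "0 \<le> t"
  shows "\<bar>f s - f t\<bar> \<le> C * \<bar>s - t\<bar>"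
  using field_differentiable_bound[of "{0..}" f f' C s t] assms by auto

section \<open>Global solutions of Lipschitz differential equations\<close>

text \<open>By Picard iteration.  Consecutive iterates differ by at most \<open>C exp (2 L t) / 2\<^sup>n\<close>: integrating
  the weight \<open>exp (2 L t)\<close> against the Lipschitz constant \<open>L\<close> gains the factor \<open>1/2\<close>, so the
  iteration converges on every bounded interval without any continuation argument.\<close>

lemma lipschitz_ode_halfline:
  fixes g :: "'b::banach \<Rightarrow> 'b"
  assumes L: "0 < L" and lip: "\<And>p q. norm (g p - g q) \<le> L * norm (p - q)"
  shows "\<exists>x. x 0 = x0 \<and> (\<forall>t\<ge>0. (x has_vector_derivative g (x t)) (at t within {0..}))"
proof -
  define X where "X = rec_nat (\<lambda>t. x0) (\<lambda>n f t. x0 + integral {0..t::real} (\<lambda>s. g (f s)))"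
  have X0: "X 0 t = x0" and XS: "X (Suc n) t = x0 + integral {0..t} (\<lambda>s. g (X n s))" for n t
    by (simp_all add: X_def)
  have contg: "continuous_on UNIV g"
    by (rule lipschitz_on_continuous_on[of L]) (auto simp: lipschitz_on_def dist_norm L lip less_imp_le)
  have contgc: "continuous_on A (\<lambda>s. g (f s))" if "continuous_on A f" for A :: "real set" and f
    by (rule continuous_on_compose2[OF contg that]) auto
  have contX: "continuous_on {0..} (X n)" for n
  proof (induction n)
    case 0 then show ?case by (simp add: X0 [abs_def])
  next
    case (Suc n)
    have "((\<lambda>t. X (Suc n) t) has_vector_derivative g (X n t)) (at t within {0..})" if "0 \<le> t" for t
      unfolding XS using integral_has_vector_derivative_halfline[OF contgc[OF Suc] that]
      by (auto intro!: derivative_eq_intros)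
    then show ?case
      by (intro continuous_on_vector_derivative[where f' = "\<lambda>t. g (X n t)"]) simp
  qed
  have intg: "(\<lambda>s. g (X n s)) integrable_on {0..t}" for n t
    by (intro integrable_continuous_interval continuous_on_subset[OF contgc[OF contX]]) auto
  define C where "C = norm (g x0) / (2 * L)"
  have C0: "0 \<le> C" using L by (simp add: C_def)
  have est: "norm (X (Suc n) t - X n t) \<le> C * exp (2 * L * t) / 2 ^ n" if "0 \<le> t" for n t
    using that
  proof (induction n arbitrary: t)
    case 0
    have "norm (X (Suc 0) t - X 0 t) = norm (g x0) * t" using 0 by (simp add: XS X0)
    also have "\<dots> = C * (2 * L * t)" using L by (simp add: C_def)
    also have "\<dots> \<le> C * exp (2 * L * t)"
      using C0 exp_ge_add_one_self[of "2 * L * t"] by (intro mult_left_mono) linarith+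
    finally show ?case by simp
  next
    case (Suc n)
    define c where "c = C / 2 ^ n"
    have "((\<lambda>s. c / 2 * exp (2 * L * s)) has_vector_derivative L * c * exp (2 * L * s)) (at s within {0..})"
      for s
      unfolding has_real_derivative_iff_has_vector_derivative[symmetric]
      by (auto intro!: derivative_eq_intros)
    from has_integral_of_deriv_halfline[OF this \<open>0 \<le> t\<close>]
    have I: "((\<lambda>s. L * c * exp (2 * L * s)) has_integral (c / 2 * exp (2 * L * t) - c / 2)) {0..t}"
      by simp
    have "X (Suc (Suc n)) t - X (Suc n) t
          = integral {0..t} (\<lambda>s. g (X (Suc n) s) - g (X n s))"
      unfolding XS[of "Suc n" t] XS[of n t] integral_diff[OF intg intg] by simp
    also have "norm \<dots> \<le> integral {0..t} (\<lambda>s. L * c * exp (2 * L * s))"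
    proof (rule integral_norm_bound_integral)
      show "(\<lambda>s. g (X (Suc n) s) - g (X n s)) integrable_on {0..t}"
        by (intro integrable_diff intg)
      show "(\<lambda>s. L * c * exp (2 * L * s)) integrable_on {0..t}" using I by blast
      fix s assume "s \<in> {0..t}"
      then have "norm (X (Suc n) s - X n s) \<le> c * exp (2 * L * s)"
        using Suc.IH[of s] by (simp add: c_def)
      then have "L * norm (X (Suc n) s - X n s) \<le> L * (c * exp (2 * L * s))"
        using L by (intro mult_left_mono) auto
      with lip[of "X (Suc n) s" "X n s"]
      show "norm (g (X (Suc n) s) - g (X n s)) \<le> L * c * exp (2 * L * s)" by (simp add: mult.assoc)
    qed
    also have "\<dots> = c / 2 * exp (2 * L * t) - c / 2" using I by blast
    also have "\<dots> \<le> C * exp (2 * L * t) / 2 ^ Suc n" using C0 by (simp add: c_def mult.commute)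
    finally show ?case .
  qed
  define x where "x = (\<lambda>t. x0 + (\<Sum>n. X (Suc n) t - X n t))"
  have unif: "uniform_limit {0..T} X x sequentially" for T
  proof -
    have "uniform_limit {0..T} (\<lambda>n t. \<Sum>i<n. X (Suc i) t - X i t) (\<lambda>t. \<Sum>i. X (Suc i) t - X i t) sequentially"
    proof (rule Weierstrass_m_test)
      fix n t assume t: "t \<in> {0..T}"
      have "C * exp (2 * L * t) / 2 ^ n \<le> C * exp (2 * L * T) / 2 ^ n"
        using t C0 L by (intro divide_right_mono mult_left_mono) auto
      then show "norm (X (Suc n) t - X n t) \<le> C * exp (2 * L * T) * (1 / 2) ^ n"
        using est[of t n] t by (simp add: power_one_over field_simps)
    next
      show "summable (\<lambda>n. C * exp (2 * L * T) * (1 / 2) ^ n)"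
        by (intro summable_mult summable_geometric) auto
    qed
    then have "uniform_limit {0..T} (\<lambda>n t. x0 + (\<Sum>i<n. X (Suc i) t - X i t)) x sequentially"
      unfolding x_def by (intro uniform_limit_add uniform_limit_const)
    moreover have "x0 + (\<Sum>i<n. X (Suc i) t - X i t) = X n t" for n t
      by (simp add: sum_lessThan_telescope[of "\<lambda>i. X i t"] X0)
    ultimately show ?thesis by simp
  qed
  have contx: "continuous_on {0..} x"
  proof -
    have "continuous_on {0..T} x" for T
      by (rule uniform_limit_theorem[OF _ unif])
         (auto intro!: always_eventually continuous_on_subset[OF contX])
    then show ?thesis by (rule continuous_on_halflineI)
  qed
  have integral_eq: "x t = x0 + integral {0..t} (\<lambda>s. g (x s))" if t: "0 \<le> t" for t
  proof -
    have "uniform_limit {0..t} (\<lambda>n s. g (X n s)) (\<lambda>s. g (x s)) sequentially"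
    proof (rule uniform_limitI)
      fix e :: real assume "0 < e"
      then have "\<forall>\<^sub>F n in sequentially. \<forall>s\<in>{0..t}. dist (X n s) (x s) < e / L"
        using L by (intro uniform_limitD[OF unif]) auto
      then show "\<forall>\<^sub>F n in sequentially. \<forall>s\<in>{0..t}. dist (g (X n s)) (g (x s)) < e"
      proof (eventually_elim, safe)
        fix n s assume "\<forall>s\<in>{0..t}. dist (X n s) (x s) < e / L" "s \<in> {0..t}"
        then have "L * norm (X n s - x s) < e" using L by (simp add: dist_norm field_simps)
        then show "dist (g (X n s)) (g (x s)) < e"
          using lip[of "X n s" "x s"] by (simp add: dist_norm)
      qed
    qed
    then obtain I J where IJ: "\<And>n. ((\<lambda>s. g (X n s)) has_integral I n) {0..t}"
        "((\<lambda>s. g (x s)) has_integral J) {0..t}" "I \<longlonglongrightarrow> J"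
      by (rule uniform_limit_integral)
         (auto intro!: continuous_on_subset[OF contgc[OF contX]])
    have "(\<lambda>n. x0 + I n) \<longlonglongrightarrow> x0 + J" by (intro tendsto_intros IJ)
    moreover have "x0 + I n = X (Suc n) t" for n
      unfolding XS using IJ(1)[of n] by (simp add: integral_unique)
    moreover have "(\<lambda>n. X (Suc n) t) \<longlonglongrightarrow> x t"
      using tendsto_uniform_limitI[OF unif[of t], of t] t by (intro LIMSEQ_Suc) auto
    ultimately have "x t = x0 + J" using LIMSEQ_unique by fastforce
    then show ?thesis using IJ(2) by (simp add: integral_unique)
  qed
  have "(x has_vector_derivative g (x t)) (at t within {0..})" if t: "0 \<le> t" for t
  proof (rule has_vector_derivative_transform)
    show "t \<in> {0..}" using t by simp
    show "\<And>s. s \<in> {0..} \<Longrightarrow> x s = x0 + integral {0..s} (\<lambda>s. g (x s))" by (rule integral_eq) simp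
    show "((\<lambda>s. x0 + integral {0..s} (\<lambda>s. g (x s))) has_vector_derivative g (x t)) (at t within {0..})"
      using integral_has_vector_derivative_halfline[OF contgc[OF contx] t]
      by (auto intro!: derivative_eq_intros)
  qed
  moreover have "x 0 = x0" using integral_eq[of 0] by simp
  ultimately show ?thesis by blast
qed

section \<open>Series with uniformly small tails\<close>

lemma summable_if_small_tails:
  fixes f :: "nat \<Rightarrow> 'b::banach"
  assumes "\<And>\<epsilon>. 0 < \<epsilon> \<Longrightarrow> \<exists>k. \<forall>n. norm (sum f {k..<n}) \<le> \<epsilon>"
  shows "summable f"
  unfolding summable_Cauchy
proof (intro allI impI)
  fix \<epsilon> :: real assume "0 < \<epsilon>"
  then obtain k where k: "\<And>n. norm (sum f {k..<n}) \<le> \<epsilon> / 3" using assms[of "\<epsilon> / 3"] by auto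
  have "norm (sum f {p..<n}) < \<epsilon>" if p: "k \<le> p" for p n
  proof (cases "p \<le> n")
    case True
    have "sum f {p..<n} = sum f {k..<n} - sum f {k..<p}"
      using sum.atLeastLessThan_concat[OF p True, of f] by (simp add: algebra_simps)
    then show ?thesis using norm_triangle_ineq4[of "sum f {k..<n}" "sum f {k..<p}"] k[of n] k[of p] \<open>0 < \<epsilon>\<close>
      by simp
  qed (use \<open>0 < \<epsilon>\<close> in simp)
  then show "\<exists>N. \<forall>p\<ge>N. \<forall>n. norm (sum f {p..<n}) < \<epsilon>" by blast
qed

lemma norm_suminf_tail_le:
  fixes f :: "nat \<Rightarrow> 'b::banach"
  assumes "summable f" "\<And>n. norm (sum f {k..<n}) \<le> \<epsilon>"
  shows "norm (suminf f - sum f {..<k}) \<le> \<epsilon>"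
proof (rule LIMSEQ_le_const2)
  show "(\<lambda>n. norm (sum f {..<n} - sum f {..<k})) \<longlonglongrightarrow> norm (suminf f - sum f {..<k})"
    by (intro tendsto_intros summable_LIMSEQ assms)
  have "sum f {..<n} - sum f {..<k} = sum f {k..<n}" if "k \<le> n" for n
    using sum.atLeastLessThan_concat[of 0 k n f] that by (simp add: lessThan_atLeast0 algebra_simps)
  then show "\<exists>N. \<forall>n\<ge>N. norm (sum f {..<n} - sum f {..<k}) \<le> \<epsilon>"
    using assms(2) by (metis (no_types, lifting))
qed

lemma small_tails_limit:
  fixes f :: "'x \<Rightarrow> nat \<Rightarrow> 'b::banach"
  assumes "F \<noteq> bot" and "\<And>i. ((\<lambda>x. f x i) \<longlongrightarrow> g i) F" and "eventually (\<lambda>x. x \<in> X) F"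
    and "\<And>x n. x \<in> X \<Longrightarrow> norm (sum (f x) {k..<n}) \<le> \<epsilon>"
  shows "norm (sum g {k..<n}) \<le> \<epsilon>"
proof (rule tendsto_upperbound)
  show "((\<lambda>x. norm (sum (f x) {k..<n})) \<longlongrightarrow> norm (sum g {k..<n})) F"
    by (intro tendsto_intros assms)
  show "\<forall>\<^sub>F x in F. norm (sum (f x) {k..<n}) \<le> \<epsilon>"
    using assms(3) by eventually_elim (rule assms(4))
qed (rule assms)

text \<open>If the tails are small uniformly in the parameter, limit and sum may be exchanged, because up to an
  arbitrarily small error only finitely many terms matter.  This is used both for sequences of approximate
  solutions and for the continuity in time of a series.\<close>

lemma tendsto_suminf_small_tails:
  fixes f :: "'x \<Rightarrow> nat \<Rightarrow> 'b::banach"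
  assumes lim: "\<And>i. ((\<lambda>x. f x i) \<longlongrightarrow> g i) F" and X: "eventually (\<lambda>x. x \<in> X) F"
    and tails: "\<And>\<epsilon>. 0 < \<epsilon> \<Longrightarrow> \<exists>k. \<forall>x\<in>X. \<forall>n. norm (sum (f x) {k..<n}) \<le> \<epsilon>"
  shows "((\<lambda>x. suminf (f x)) \<longlongrightarrow> suminf g) F"
proof (cases "F = bot")
  case False
  have tails_g: "\<exists>k. (\<forall>x\<in>X. \<forall>n. norm (sum (f x) {k..<n}) \<le> \<epsilon>) \<and> (\<forall>n. norm (sum g {k..<n}) \<le> \<epsilon>)"
    if "0 < \<epsilon>" for \<epsilon>
  proof -
    obtain k where k: "\<forall>x\<in>X. \<forall>n. norm (sum (f x) {k..<n}) \<le> \<epsilon>" using tails[OF \<open>0 < \<epsilon>\<close>] by blast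
    then have "norm (sum g {k..<n}) \<le> \<epsilon>" for n
      by (intro small_tails_limit[OF False lim X]) auto
    with k show ?thesis by blast
  qed
  have sg: "summable g" using tails_g by (intro summable_if_small_tails) blast
  have sf: "summable (f x)" if "x \<in> X" for x
    using tails that by (intro summable_if_small_tails) blast
  show ?thesis
  proof (rule tendstoI)
    fix \<epsilon> :: real assume \<epsilon>: "0 < \<epsilon>"
    then have \<epsilon>4: "0 < \<epsilon> / 4" by simp
    obtain k where k: "\<And>x n. x \<in> X \<Longrightarrow> norm (sum (f x) {k..<n}) \<le> \<epsilon> / 4"
        "\<And>n. norm (sum g {k..<n}) \<le> \<epsilon> / 4"
      using tails_g[OF \<epsilon>4] by (elim exE conjE) blast
    have "((\<lambda>x. sum (f x) {..<k}) \<longlongrightarrow> sum g {..<k}) F" by (intro tendsto_intros lim)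
    then have "\<forall>\<^sub>F x in F. dist (sum (f x) {..<k}) (sum g {..<k}) < \<epsilon> / 4" by (rule tendstoD[OF _ \<epsilon>4])
    with X show "\<forall>\<^sub>F x in F. dist (suminf (f x)) (suminf g) < \<epsilon>"
    proof eventually_elim
      case (elim x)
      have 1: "norm (suminf (f x) - sum (f x) {..<k}) \<le> \<epsilon> / 4"
        using elim k by (intro norm_suminf_tail_le sf) auto
      have 2: "norm (suminf g - sum g {..<k}) \<le> \<epsilon> / 4"
        using k by (intro norm_suminf_tail_le sg) auto
      have "suminf (f x) - suminf g = (suminf (f x) - sum (f x) {..<k})
          + (sum (f x) {..<k} - sum g {..<k}) - (suminf g - sum g {..<k})" by simp
      also have "norm \<dots> \<le> norm (suminf (f x) - sum (f x) {..<k})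
          + norm (sum (f x) {..<k} - sum g {..<k}) + norm (suminf g - sum g {..<k})"
        by (meson add_mono norm_triangle_ineq norm_triangle_ineq4 order_refl order_trans)
      finally show ?case using 1 2 elim(2) \<epsilon> by (simp add: dist_norm)
    qed
  qed
qed simp

lemma continuous_on_suminf_small_tails:
  fixes f :: "real \<Rightarrow> nat \<Rightarrow> 'b::banach"
  assumes cont: "\<And>i. continuous_on {0..} (\<lambda>t. f t i)"
    and tails: "\<And>T \<epsilon>. 0 \<le> T \<Longrightarrow> 0 < \<epsilon> \<Longrightarrow> \<exists>k. \<forall>t\<in>{0..T}. \<forall>n. norm (sum (f t) {k..<n}) \<le> \<epsilon>"
  shows "continuous_on {0..} (\<lambda>t. suminf (f t))"
  unfolding continuous_on_def
proof
  fix t :: real assume t: "t \<in> {0..}"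
  show "((\<lambda>s. suminf (f s)) \<longlongrightarrow> suminf (f t)) (at t within {0..})"
  proof (rule tendsto_suminf_small_tails)
    show "((\<lambda>s. f s i) \<longlongrightarrow> f t i) (at t within {0..})" for i
      using cont[of i] t by (simp add: continuous_on_def)
    show "\<forall>\<^sub>F s in at t within {0..}. s \<in> {0..t + 1}"
      unfolding eventually_at by (rule exI[of _ 1]) (auto simp: dist_real_def)
    show "\<exists>k. \<forall>s\<in>{0..t + 1}. \<forall>n. norm (sum (f s) {k..<n}) \<le> \<epsilon>" if "0 < \<epsilon>" for \<epsilon>
      using t that by (intro tails) simp_all
  qed
qed

section \<open>Limits of equi-Lipschitz functions on the half-line\<close>

lemma convergent_if_lipschitz_convergent_on_Rats:
  fixes f :: "nat \<Rightarrow> real \<Rightarrow> real"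
  assumes lip: "\<And>n s t. 0 \<le> s \<Longrightarrow> 0 \<le> t \<Longrightarrow> \<bar>f n s - f n t\<bar> \<le> C * \<bar>s - t\<bar>"
    and conv: "\<And>q. q \<in> \<rat> \<Longrightarrow> 0 \<le> q \<Longrightarrow> convergent (\<lambda>n. f n q)" and t: "0 \<le> t"
  shows "convergent (\<lambda>n. f n t)"
proof -
  have "Cauchy (\<lambda>n. f n t)"
    unfolding Cauchy_def
  proof (intro allI impI)
    fix \<epsilon> :: real assume \<epsilon>: "0 < \<epsilon>"
    define d where "d = \<epsilon> / 3 / (\<bar>C\<bar> + 1)"
    have "0 < \<bar>C\<bar> + 1" by simp
    have "0 < d" using \<epsilon> \<open>0 < \<bar>C\<bar> + 1\<close> by (simp add: d_def)
    then obtain q where q: "q \<in> \<rat>" "t < q" "q < t + d"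
      using Rats_dense_in_real[of t "t + d"] by auto
    have "C * \<bar>q - t\<bar> \<le> (\<bar>C\<bar> + 1) * d" using q by (intro mult_mono) auto
    also have "\<dots> = \<epsilon> / 3" using \<open>0 < \<bar>C\<bar> + 1\<close> by (simp add: d_def del: divide_divide_eq_left)
    finally have Cq: "\<bar>f n q - f n t\<bar> \<le> \<epsilon> / 3" for n using lip[of q t n] q t by simp
    have "Cauchy (\<lambda>n. f n q)" using conv[of q] q t by (simp add: Cauchy_convergent_iff)
    then obtain M where M: "\<And>i j. M \<le> i \<Longrightarrow> M \<le> j \<Longrightarrow> dist (f i q) (f j q) < \<epsilon> / 3"
      using \<epsilon> unfolding Cauchy_def by (metis zero_less_divide_iff zero_less_numeral)
    have "dist (f i t) (f j t) < \<epsilon>" if "M \<le> i" "M \<le> j" for i j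
      using M[OF that] Cq[of i] Cq[of j] unfolding dist_real_def by linarith
    then show "\<exists>M. \<forall>i\<ge>M. \<forall>j\<ge>M. dist (f i t) (f j t) < \<epsilon>" by blast
  qed
  then show ?thesis by (simp add: Cauchy_convergent_iff)
qed

lemma continuous_on_limit_lipschitz:
  fixes f :: "nat \<Rightarrow> real \<Rightarrow> real"
  assumes lip: "\<And>n s t. 0 \<le> s \<Longrightarrow> 0 \<le> t \<Longrightarrow> \<bar>f n s - f n t\<bar> \<le> C * \<bar>s - t\<bar>"
    and lim: "\<And>t. 0 \<le> t \<Longrightarrow> (\<lambda>n. f n t) \<longlonglongrightarrow> g t"
  shows "continuous_on {0..} g"
proof (rule lipschitz_on_continuous_on[of "\<bar>C\<bar>"])
  show "\<bar>C\<bar>-lipschitz_on {0..} g"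
  proof (rule lipschitz_onI)
    fix s t :: real assume st: "s \<in> {0..}" "t \<in> {0..}"
    have le: "\<bar>f n s - f n t\<bar> \<le> \<bar>C\<bar> * \<bar>s - t\<bar>" for n
      using lip[of s t n] st mult_right_mono[OF abs_ge_self[of C], of "\<bar>s - t\<bar>"] by simp
    have "(\<lambda>n. \<bar>f n s - f n t\<bar>) \<longlonglongrightarrow> \<bar>g s - g t\<bar>"
      using st by (intro tendsto_intros lim) auto
    then show "dist (g s) (g t) \<le> \<bar>C\<bar> * dist s t"
      unfolding dist_real_def by (rule LIMSEQ_le_const2) (blast intro: le)
  qed simp
qed

text \<open>By dominated convergence in the integrated form of the hypothesis; pointwise limits suffice once the
  limit of the derivatives is known to be continuous.\<close>

lemma has_real_derivative_limit_halfline: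
  fixes f :: "nat \<Rightarrow> real \<Rightarrow> real"
  assumes f': "\<And>n t. 0 \<le> t \<Longrightarrow> (f n has_real_derivative f' n t) (at t within {0..})"
    and bound: "\<And>n t. 0 \<le> t \<Longrightarrow> \<bar>f' n t\<bar> \<le> C"
    and lim: "\<And>t. 0 \<le> t \<Longrightarrow> (\<lambda>n. f n t) \<longlonglongrightarrow> g t"
    and lim': "\<And>t. 0 \<le> t \<Longrightarrow> (\<lambda>n. f' n t) \<longlonglongrightarrow> g' t"
    and cont: "continuous_on {0..} g'" and t: "0 \<le> t"
  shows "(g has_real_derivative g' t) (at t within {0..})"
proof -
  have eq: "g s = g 0 + integral {0..s} g'" if s: "0 \<le> s" for s
  proof -
    have I: "(f' n has_integral (f n s - f n 0)) {0..s}" for n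
      using f' s by (intro has_integral_of_deriv_halfline)
        (simp_all add: has_real_derivative_iff_has_vector_derivative)
    have "(\<lambda>n. integral {0..s} (f' n)) \<longlonglongrightarrow> integral {0..s} g'"
    proof (rule dominated_convergence(2)[where h = "\<lambda>_. C"])
      show "f' n integrable_on {0..s}" for n using I by (rule has_integral_integrable)
      show "(\<lambda>_. C) integrable_on {0..s}" by (rule integrable_const_ivl)
      show "norm (f' n x) \<le> C" if "x \<in> {0..s}" for n x using bound that by simp
      show "(\<lambda>n. f' n x) \<longlonglongrightarrow> g' x" if "x \<in> {0..s}" for x using lim' that by simp
    qed
    moreover have "integral {0..s} (f' n) = f n s - f n 0" for n
      using I by (rule integral_unique)
    moreover have "(\<lambda>n. f n s - f n 0) \<longlonglongrightarrow> g s - g 0" using s by (intro tendsto_intros lim) auto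
    ultimately show ?thesis using LIMSEQ_unique by fastforce
  qed
  have "(g has_vector_derivative g' t) (at t within {0..})"
  proof (rule has_vector_derivative_transform)
    show "t \<in> {0..}" using t by simp
    show "\<And>s. s \<in> {0..} \<Longrightarrow> g s = g 0 + integral {0..s} g'" by (rule eq) simp
    show "((\<lambda>s. g 0 + integral {0..s} g') has_vector_derivative g' t) (at t within {0..})"
      using integral_has_vector_derivative_halfline[OF cont t] by (auto intro!: derivative_eq_intros)
  qed
  then show ?thesis by (simp add: has_real_derivative_iff_has_vector_derivative)
qed

section \<open>A priori estimates for finitely many modes\<close>

text \<open>The nonlinearity is assumed to be bounded and Lipschitz on the whole half-line; this is achieved by a
  cut-off.  The normalization \<open>1 \<le> K\<close> lets \<open>K\<close> bound potential and kinetic energy together.\<close>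

locale kirchhoff_coefficients =
  fixes l :: "nat \<Rightarrow> real" and m :: "real \<Rightarrow> real" and \<mu> K L :: real
  assumes l_pos: "0 < l i" and l_mono: "mono l"
    and \<mu>_pos: "0 < \<mu>" and K_ge: "1 \<le> K"
    and m_ge: "0 \<le> \<sigma> \<Longrightarrow> \<mu> \<le> m \<sigma>" and m_le: "0 \<le> \<sigma> \<Longrightarrow> m \<sigma> \<le> K"
    and L_nonneg: "0 \<le> L"
    and m_lip: "0 \<le> \<sigma> \<Longrightarrow> 0 \<le> \<tau> \<Longrightarrow> \<bar>m \<sigma> - m \<tau>\<bar> \<le> L * \<bar>\<sigma> - \<tau>\<bar>"
begin

definition M :: "real \<Rightarrow> real" where
  "M \<sigma> = integral {0..\<sigma>} m"

lemma continuous_m: "continuous_on {0..} m"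
  by (rule lipschitz_on_continuous_on[of L]) (auto simp: lipschitz_on_def dist_real_def L_nonneg m_lip)

lemma M_0 [simp]: "M 0 = 0"
  by (simp add: M_def)

lemma M_deriv: "0 \<le> \<sigma> \<Longrightarrow> (M has_real_derivative m \<sigma>) (at \<sigma> within {0..})"
  unfolding has_real_derivative_iff_has_vector_derivative M_def [abs_def]
  by (rule integral_has_vector_derivative_halfline[OF continuous_m])

lemma continuous_M: "continuous_on {0..} M"
  by (rule DERIV_continuous_on[OF M_deriv]) simp

lemma M_diff_bounds:
  assumes "0 \<le> \<sigma>" "\<sigma> \<le> \<tau>"
  shows "\<mu> * (\<tau> - \<sigma>) \<le> M \<tau> - M \<sigma>" and "M \<tau> - M \<sigma> \<le> K * (\<tau> - \<sigma>)"
proof -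
  have i: "m integrable_on {0..\<tau>}" "m integrable_on {\<sigma>..\<tau>}"
    using assms by (auto intro!: integrable_continuous_interval continuous_on_subset[OF continuous_m])
  have eq: "M \<tau> - M \<sigma> = integral {\<sigma>..\<tau>} m"
    using Henstock_Kurzweil_Integration.integral_combine[of 0 \<sigma> \<tau> m] assms i by (simp add: M_def)
  have "integral {\<sigma>..\<tau>} (\<lambda>_. \<mu>) \<le> integral {\<sigma>..\<tau>} m"
    by (rule integral_le) (use i m_ge assms in auto)
  then show "\<mu> * (\<tau> - \<sigma>) \<le> M \<tau> - M \<sigma>" using assms eq by (simp add: mult.commute)
  have "integral {\<sigma>..\<tau>} m \<le> integral {\<sigma>..\<tau>} (\<lambda>_. K)"
    by (rule integral_le) (use i m_le assms in auto)
  then show "M \<tau> - M \<sigma> \<le> K * (\<tau> - \<sigma>)" using assms eq by (simp add: mult.commute)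
qed

end

text \<open>The first \<open>N\<close> modes of the equation in the unknown coefficients \<open>y i\<close>, with velocities \<open>z i\<close>.  All
  other modes are set to zero, so that sums over the modes may be read as series.\<close>

locale galerkin = kirchhoff_coefficients +
  fixes N :: nat and y z :: "nat \<Rightarrow> real \<Rightarrow> real"
  assumes y_deriv: "0 \<le> t \<Longrightarrow> (y i has_real_derivative z i t) (at t within {0..})"
    and z_deriv: "0 \<le> t \<Longrightarrow> (z i has_real_derivative
          - ((l i)\<^sup>2 * m (\<Sum>j<N. (l j * y j t)\<^sup>2) * y i t)) (at t within {0..})"
    and y_zero: "0 \<le> t \<Longrightarrow> N \<le> i \<Longrightarrow> y i t = 0" and z_zero: "0 \<le> t \<Longrightarrow> N \<le> i \<Longrightarrow> z i t = 0"
begin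

definition Q :: "nat \<Rightarrow> real \<Rightarrow> real" where
  "Q k t = (\<Sum>j<k. (l j * y j t)\<^sup>2)"

definition Q' :: "nat \<Rightarrow> real \<Rightarrow> real" where
  "Q' k t = (\<Sum>j<k. 2 * (l j)\<^sup>2 * y j t * z j t)"

text \<open>What remains of the conserved energy after subtracting the energy that the modes below \<open>k\<close> would have
  on their own.  The potential part has to be a difference of values of \<open>M\<close>: for the plain sum
  of the energies of the high modes, with a time-dependent coefficient, the growth rate would involve the
  derivative of the coefficient, hence the highest frequency of the system.\<close>

definition tail_energy :: "nat \<Rightarrow> real \<Rightarrow> real" where
  "tail_energy k t = (\<Sum>i=k..<N. (z i t)\<^sup>2) + (M (Q N t) - M (Q k t))"

lemma Q_nonneg: "0 \<le> Q k t"
  by (simp add: Q_def sum_nonneg)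

lemma Q_diff: "k \<le> N \<Longrightarrow> Q N t - Q k t = (\<Sum>i=k..<N. (l i * y i t)\<^sup>2)"
  using sum.atLeastLessThan_concat[of 0 k N "\<lambda>i. (l i * y i t)\<^sup>2"]
  by (simp add: Q_def lessThan_atLeast0)

lemma Q_mono: "k \<le> N \<Longrightarrow> Q k t \<le> Q N t"
  using Q_diff[of k t] by (simp add: sum_nonneg algebra_simps)

lemma Q_deriv: "0 \<le> t \<Longrightarrow> (Q k has_real_derivative Q' k t) (at t within {0..})"
  unfolding Q_def [abs_def] Q'_def
  by (auto intro!: derivative_eq_intros y_deriv sum.cong simp: power2_eq_square)

lemma M_Q_deriv:
  assumes "0 \<le> t"
  shows "((\<lambda>t. M (Q k t)) has_real_derivative m (Q k t) * Q' k t) (at t within {0..})"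
proof -
  have "(M has_real_derivative m (Q k t)) (at (Q k t) within Q k ` {0..})"
    by (rule DERIV_subset[OF M_deriv[OF Q_nonneg]]) (auto simp: Q_nonneg)
  from DERIV_image_chain[OF this Q_deriv[OF assms]] show ?thesis by (simp add: o_def)
qed

text \<open>Differentiating the total energy cancels all forces that act inside the tail; what remains is
  the work done on the low modes by the change that the tail causes in the coefficient.\<close>

lemma tail_energy_deriv:
  assumes "k \<le> N" "0 \<le> t"
  shows "(tail_energy k has_real_derivative (m (Q N t) - m (Q k t)) * Q' k t) (at t within {0..})"
proof -
  have Q'_diff: "Q' N t - Q' k t = (\<Sum>i=k..<N. 2 * (l i)\<^sup>2 * y i t * z i t)"
    using sum.atLeastLessThan_concat[of 0 k N "\<lambda>i. 2 * (l i)\<^sup>2 * y i t * z i t"] assms(1)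
    by (simp add: Q'_def lessThan_atLeast0)
  have V: "((\<lambda>t. \<Sum>i=k..<N. (z i t)\<^sup>2) has_real_derivative
          (\<Sum>i=k..<N. - (m (Q N t) * (2 * (l i)\<^sup>2 * y i t * z i t)))) (at t within {0..})"
    by (auto intro!: derivative_eq_intros z_deriv assms sum.cong simp: power2_eq_square Q_def)
  have W: "(\<Sum>i=k..<N. - (m (Q N t) * (2 * (l i)\<^sup>2 * y i t * z i t)))
             = - m (Q N t) * (Q' N t - Q' k t)"
    unfolding Q'_diff sum_distrib_left by simp
  show ?thesis
    unfolding tail_energy_def [abs_def]
    by (rule DERIV_cong[OF DERIV_add[OF V[unfolded W]
          DERIV_diff[OF M_Q_deriv[OF assms(2), of N] M_Q_deriv[OF assms(2), of k]]]])
       (simp add: algebra_simps)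
qed

text \<open>The tail energy for \<open>k = 0\<close>, where there are no low modes to work on.\<close>

lemma energy_conserved:
  assumes "0 \<le> t"
  shows "(\<Sum>i<N. (z i t)\<^sup>2) + M (Q N t) = (\<Sum>i<N. (z i 0)\<^sup>2) + M (Q N 0)"
proof -
  have "tail_energy 0 t = tail_energy 0 0"
    by (rule constant_halfline[OF _ assms]) (use tail_energy_deriv[of 0] in \<open>simp add: Q'_def\<close>)
  then show ?thesis by (simp add: tail_energy_def Q_def lessThan_atLeast0)
qed

lemma tail_energy_ge:
  assumes "k \<le> N"
  shows "(\<Sum>i=k..<N. (z i t)\<^sup>2) + \<mu> * (Q N t - Q k t) \<le> tail_energy k t"
  using M_diff_bounds(1)[OF Q_nonneg Q_mono[OF assms]] by (simp add: tail_energy_def)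

context
  fixes G :: real
  assumes G: "(\<Sum>i<N. (z i 0)\<^sup>2) + M (Q N 0) \<le> G"
begin

lemma energy_bounds:
  assumes "0 \<le> t"
  shows "(\<Sum>i<N. (z i t)\<^sup>2) \<le> G" and "Q N t \<le> G / \<mu>"
proof -
  have 1: "(\<Sum>i<N. (z i t)\<^sup>2) + M (Q N t) \<le> G" using G energy_conserved[OF assms] by simp
  have 2: "\<mu> * Q N t \<le> M (Q N t)" using M_diff_bounds(1)[of 0 "Q N t"] Q_nonneg by simp
  have 3: "0 \<le> (\<Sum>i<N. (z i t)\<^sup>2)" by (simp add: sum_nonneg)
  have 4: "0 \<le> \<mu> * Q N t" using Q_nonneg \<mu>_pos by simp
  show "(\<Sum>i<N. (z i t)\<^sup>2) \<le> G" using 1 2 4 by linarith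
  have "\<mu> * Q N t \<le> G" using 1 2 3 by linarith
  then show "Q N t \<le> G / \<mu>" using \<mu>_pos by (simp add: field_simps)
qed

text \<open>The low modes have frequency at most \<open>l (k - 1)\<close>, so this frequency is all that enters the
  growth rate of the tail, however high the frequencies in the tail are.\<close>

lemma tail_energy_growth:
  assumes k: "1 \<le> k" "k \<le> N" and t: "0 \<le> t"
  shows "tail_energy k t \<le> tail_energy k 0 * exp (L / \<mu> * (G + G / \<mu>) * l (k - 1) * t)"
proof (rule gronwall_halfline[OF tail_energy_deriv[OF k(2)] _ t])
  fix t :: real assume t: "0 \<le> t"
  have "\<bar>2 * (l j)\<^sup>2 * y j t * z j t\<bar> \<le> l (k - 1) * ((l j * y j t)\<^sup>2 + (z j t)\<^sup>2)" if "j < k" for j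
  proof -
    have "2 * (\<bar>l j * y j t\<bar> * \<bar>z j t\<bar>) \<le> (l j * y j t)\<^sup>2 + (z j t)\<^sup>2"
      using sum_squares_bound[of "\<bar>l j * y j t\<bar>" "\<bar>z j t\<bar>"] by simp
    then have "l j * (2 * (\<bar>l j * y j t\<bar> * \<bar>z j t\<bar>)) \<le> l j * ((l j * y j t)\<^sup>2 + (z j t)\<^sup>2)"
      using l_pos[of j] by simp
    also have "\<dots> \<le> l (k - 1) * ((l j * y j t)\<^sup>2 + (z j t)\<^sup>2)"
      using l_mono that by (intro mult_right_mono) (auto simp: mono_def)
    finally show ?thesis using l_pos[of j] by (simp add: abs_mult power2_eq_square mult_ac)
  qed
  then have "\<bar>Q' k t\<bar> \<le> (\<Sum>j<k. l (k - 1) * ((l j * y j t)\<^sup>2 + (z j t)\<^sup>2))"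
    unfolding Q'_def by (intro order_trans[OF sum_abs] sum_mono) auto
  also have "\<dots> = l (k - 1) * (Q k t + (\<Sum>j<k. (z j t)\<^sup>2))"
    by (simp add: Q_def sum.distrib flip: sum_distrib_left)
  also have "\<dots> \<le> l (k - 1) * (G / \<mu> + G)"
  proof (intro mult_left_mono add_mono)
    show "Q k t \<le> G / \<mu>" using Q_mono[OF k(2)] energy_bounds(2)[OF t] by (rule order_trans)
    have "(\<Sum>j<k. (z j t)\<^sup>2) \<le> (\<Sum>j<N. (z j t)\<^sup>2)" using k by (intro sum_mono2) auto
    then show "(\<Sum>j<k. (z j t)\<^sup>2) \<le> G" using energy_bounds(1)[OF t] by linarith
  qed (use l_pos less_imp_le in blast)
  finally have Q'_le: "\<bar>Q' k t\<bar> \<le> l (k - 1) * (G / \<mu> + G)" .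
  have "0 \<le> (\<Sum>i=k..<N. (z i t)\<^sup>2)" by (simp add: sum_nonneg)
  then have "\<mu> * (Q N t - Q k t) \<le> tail_energy k t" using tail_energy_ge[OF k(2), of t] by linarith
  then have Q_le: "Q N t - Q k t \<le> tail_energy k t / \<mu>" using \<mu>_pos by (simp add: field_simps)
  have "\<bar>m (Q N t) - m (Q k t)\<bar> \<le> L * (Q N t - Q k t)"
    using m_lip[OF Q_nonneg Q_nonneg, of N t k t] Q_mono[OF k(2), of t] by simp
  also have "\<dots> \<le> L * (tail_energy k t / \<mu>)" using Q_le L_nonneg by (rule mult_left_mono)
  finally have "\<bar>m (Q N t) - m (Q k t)\<bar> * \<bar>Q' k t\<bar>
      \<le> L * (tail_energy k t / \<mu>) * (l (k - 1) * (G / \<mu> + G))"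
  proof (rule mult_mono[OF _ Q'_le])
    have "0 \<le> tail_energy k t / \<mu>" using Q_le Q_mono[OF k(2), of t] by linarith
    then show "0 \<le> L * (tail_energy k t / \<mu>)" using L_nonneg by (rule mult_nonneg_nonneg[rotated])
  qed auto
  also have "L * (tail_energy k t / \<mu>) * (l (k - 1) * (G / \<mu> + G))
      = L / \<mu> * (G + G / \<mu>) * l (k - 1) * tail_energy k t"
    by (simp add: algebra_simps)
  finally have "\<bar>(m (Q N t) - m (Q k t)) * Q' k t\<bar>
      \<le> L / \<mu> * (G + G / \<mu>) * l (k - 1) * tail_energy k t"
    by (simp only: abs_mult)
  then show "(m (Q N t) - m (Q k t)) * Q' k t \<le> L / \<mu> * (G + G / \<mu>) * l (k - 1) * tail_energy k t"
    by linarith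
qed

text \<open>The tail energy is comparable, with constants \<open>\<mu>\<close> and \<open>K\<close>, to the sum of squares of the
  high modes, so its growth estimate carries over to these.\<close>

lemma tail_bound:
  assumes k: "1 \<le> k" and t: "0 \<le> t"
  shows "(\<Sum>i=k..<n. (l i * y i t)\<^sup>2 + (z i t)\<^sup>2)
    \<le> (1 + 1 / \<mu>) * K * (\<Sum>i=k..<N. (l i * y i 0)\<^sup>2 + (z i 0)\<^sup>2)
        * exp (L / \<mu> * (G + G / \<mu>) * l (k - 1) * t)"
proof (cases "k \<le> N")
  case False
  then show ?thesis using t by (simp add: y_zero z_zero)
next
  case True
  let ?S = "\<lambda>t. \<Sum>i=k..<N. (l i * y i t)\<^sup>2 + (z i t)\<^sup>2"
  let ?V = "\<lambda>t. \<Sum>i=k..<N. (z i t)\<^sup>2"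
  have S: "?S t = (Q N t - Q k t) + ?V t" for t
    using Q_diff[OF True, of t] by (simp add: sum.distrib)
  have V0: "0 \<le> ?V t" for t by (simp add: sum_nonneg)
  have D0: "0 \<le> Q N t - Q k t" for t using Q_mono[OF True, of t] by simp
  have "(\<Sum>i=k..<n. (l i * y i t)\<^sup>2 + (z i t)\<^sup>2)
      = (\<Sum>i\<in>{k..<n} \<inter> {..<N}. (l i * y i t)\<^sup>2 + (z i t)\<^sup>2)"
    by (rule sum.mono_neutral_right) (use t in \<open>auto simp: y_zero z_zero\<close>)
  also have "\<dots> \<le> ?S t" by (rule sum_mono2) auto
  also have "\<dots> \<le> (1 + 1 / \<mu>) * tail_energy k t"
  proof -
    have "Q N t - Q k t = 1 / \<mu> * (\<mu> * (Q N t - Q k t))" using \<mu>_pos by simp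
    also have "\<dots> \<le> 1 / \<mu> * tail_energy k t"
      using tail_energy_ge[OF True, of t] V0[of t] \<mu>_pos by (intro mult_left_mono) auto
    moreover have "?V t \<le> tail_energy k t"
    proof -
      have "0 \<le> \<mu> * (Q N t - Q k t)" using D0 \<mu>_pos by simp
      then show ?thesis using tail_energy_ge[OF True, of t] by linarith
    qed
    ultimately show ?thesis using S[of t] by (simp add: algebra_simps)
  qed
  also have "\<dots> \<le> (1 + 1 / \<mu>) * (tail_energy k 0 * exp (L / \<mu> * (G + G / \<mu>) * l (k - 1) * t))"
    using tail_energy_growth[OF k True t] \<mu>_pos by (intro mult_left_mono) auto
  also have "\<dots> \<le> (1 + 1 / \<mu>) * (K * ?S 0 * exp (L / \<mu> * (G + G / \<mu>) * l (k - 1) * t))"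
  proof (intro mult_left_mono mult_right_mono)
    have "?V 0 \<le> K * ?V 0" using mult_right_mono[OF K_ge V0[of 0]] by simp
    then show "tail_energy k 0 \<le> K * ?S 0"
      using M_diff_bounds(2)[OF Q_nonneg Q_mono[OF True], of 0]
      unfolding S[of 0] tail_energy_def distrib_left by linarith
  qed (use \<mu>_pos in auto)
  finally show ?thesis by (simp add: mult.assoc)
qed

end

end

section \<open>Existence of solutions with finitely many modes\<close>

locale orthonormal_sequence =
  fixes E :: "nat \<Rightarrow> 'a::{real_inner, banach}"
  assumes inner_E: "E i \<bullet> E j = (if i = j then 1 else 0)"
begin

lemma inner_sum_E:
  assumes "finite I"
  shows "(\<Sum>i\<in>I. c i *\<^sub>R E i) \<bullet> E j = (if j \<in> I then c j else 0)"
  using assms by (simp add: inner_sum_left inner_E if_distrib cong: if_cong)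

lemma norm_sum_E:
  assumes "finite I"
  shows "(norm (\<Sum>i\<in>I. c i *\<^sub>R E i))\<^sup>2 = (\<Sum>i\<in>I. (c i)\<^sup>2)"
proof -
  have "(norm (\<Sum>i\<in>I. c i *\<^sub>R E i))\<^sup>2 = (\<Sum>j\<in>I. (\<Sum>i\<in>I. c i *\<^sub>R E i) \<bullet> (c j *\<^sub>R E j))"
    by (simp only: power2_norm_eq_inner inner_sum_right)
  also have "\<dots> = (\<Sum>j\<in>I. (c j)\<^sup>2)"
    using assms by (intro sum.cong) (auto simp: inner_sum_E power2_eq_square)
  finally show ?thesis .
qed

end

text \<open>The weight \<open>s\<close> is unbounded, but the increment of \<open>m\<close> only sees \<open>min s R\<close>.  In the
  critical case \<open>r < R < s\<close> the claim is \<open>(R - r) s \<le> R (s - r)\<close>, that is \<open>R r \<le> s r\<close>.\<close>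

lemma cutoff_increment_bound:
  fixes m :: "real \<Rightarrow> real"
  assumes lip: "\<And>\<sigma> \<tau>. 0 \<le> \<sigma> \<Longrightarrow> 0 \<le> \<tau> \<Longrightarrow> \<bar>m \<sigma> - m \<tau>\<bar> \<le> L * \<bar>\<sigma> - \<tau>\<bar>"
    and L: "0 \<le> L" and R: "0 \<le> R" and cutoff: "\<And>\<sigma>. R\<^sup>2 \<le> \<sigma> \<Longrightarrow> m \<sigma> = m (R\<^sup>2)"
    and rs: "0 \<le> r" "0 \<le> s"
  shows "\<bar>m (r\<^sup>2) - m (s\<^sup>2)\<bar> * s \<le> 2 * L * R\<^sup>2 * \<bar>r - s\<bar>"
proof -
  have cut: "m (x\<^sup>2) = m ((min x R)\<^sup>2)" if "0 \<le> x" for x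
    using cutoff[of "x\<^sup>2"] R by (cases "x \<le> R") (auto simp: min_def)
  have "\<bar>m (r\<^sup>2) - m (s\<^sup>2)\<bar> \<le> L * \<bar>(min r R)\<^sup>2 - (min s R)\<^sup>2\<bar>"
    unfolding cut[OF rs(1)] cut[OF rs(2)] by (rule lip) auto
  also have "\<bar>(min r R)\<^sup>2 - (min s R)\<^sup>2\<bar> = (min r R + min s R) * \<bar>min r R - min s R\<bar>"
  proof -
    have "(min r R)\<^sup>2 - (min s R)\<^sup>2 = (min r R + min s R) * (min r R - min s R)"
      by (simp add: power2_eq_square algebra_simps)
    moreover have "0 \<le> min r R + min s R" using rs R by simp
    ultimately show ?thesis by (simp add: abs_mult)
  qed
  also have "L * \<dots> \<le> L * (2 * R * \<bar>min r R - min s R\<bar>)"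
    using L by (intro mult_left_mono mult_right_mono) auto
  finally have "\<bar>m (r\<^sup>2) - m (s\<^sup>2)\<bar> * s \<le> L * (2 * R * \<bar>min r R - min s R\<bar>) * s"
    using rs(2) by (rule mult_right_mono)
  also have "\<dots> = 2 * L * R * (\<bar>min r R - min s R\<bar> * s)" by simp
  also have "\<dots> \<le> 2 * L * R * (R * \<bar>r - s\<bar>)"
  proof (rule mult_left_mono)
    consider "s \<le> R" | "R < s" "R \<le> r" | "R < s" "r < R" by linarith
    then show "\<bar>min r R - min s R\<bar> * s \<le> R * \<bar>r - s\<bar>"
    proof cases
      case 1
      then have "\<bar>min r R - min s R\<bar> * s \<le> \<bar>r - s\<bar> * R" using rs by (intro mult_mono) auto
      then show ?thesis by (simp add: mult.commute)
    next
      case 2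
      then show ?thesis using R by simp
    next
      case 3
      then have "r * R \<le> r * s" using rs by (intro mult_left_mono) auto
      with 3 show ?thesis by (simp add: algebra_simps)
    qed
  qed (use L R in simp)
  finally show ?thesis by (simp add: power2_eq_square mult.assoc)
qed

text \<open>If \<open>m\<close> is constant beyond \<open>R\<^sup>2\<close>, the force is globally Lipschitz although the increments of its scalar
  factor are multiplied by the unbounded \<open>C q\<close>: beyond \<open>R\<close> these increments stop growing.  This is why
  \<open>C\<close> has to be controlled by the operator \<open>B\<close> that enters \<open>m\<close>.\<close>

lemma lipschitz_cutoff_force:
  fixes B C :: "'a::real_inner \<Rightarrow> 'a"
  assumes B: "bounded_linear B" and C: "bounded_linear C"
    and CB: "\<And>p. norm (C p) \<le> \<Lambda> * norm (B p)"
    and lip: "\<And>\<sigma> \<tau>. 0 \<le> \<sigma> \<Longrightarrow> 0 \<le> \<tau> \<Longrightarrow> \<bar>m \<sigma> - m \<tau>\<bar> \<le> L * \<bar>\<sigma> - \<tau>\<bar>"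
    and bound: "\<And>\<sigma>. 0 \<le> \<sigma> \<Longrightarrow> \<bar>m \<sigma>\<bar> \<le> K"
    and L: "0 \<le> L" and R: "0 \<le> R" and cutoff: "\<And>\<sigma>. R\<^sup>2 \<le> \<sigma> \<Longrightarrow> m \<sigma> = m (R\<^sup>2)"
    and \<Lambda>: "0 \<le> \<Lambda>"
  shows "\<exists>L'\<ge>0. \<forall>p q. norm (m ((norm (B p))\<^sup>2) *\<^sub>R C p - m ((norm (B q))\<^sup>2) *\<^sub>R C q)
    \<le> L' * norm (p - q)"
proof -
  obtain b where b: "0 \<le> b" "\<And>p. norm (B p) \<le> norm p * b"
    using bounded_linear.nonneg_bounded[OF B] by blast
  obtain c where c: "0 \<le> c" "\<And>p. norm (C p) \<le> norm p * c"
    using bounded_linear.nonneg_bounded[OF C] by blast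
  have K: "0 \<le> K" using bound[of 0] by simp
  have "norm (m ((norm (B p))\<^sup>2) *\<^sub>R C p - m ((norm (B q))\<^sup>2) *\<^sub>R C q)
        \<le> (K * c + \<Lambda> * (2 * L * R\<^sup>2 * b)) * norm (p - q)" for p q
  proof -
    let ?r = "norm (B p)" and ?s = "norm (B q)"
    have "m (?r\<^sup>2) *\<^sub>R C p - m (?s\<^sup>2) *\<^sub>R C q = m (?r\<^sup>2) *\<^sub>R C (p - q) + (m (?r\<^sup>2) - m (?s\<^sup>2)) *\<^sub>R C q"
      by (simp add: linear_diff[OF bounded_linear.linear[OF C]] algebra_simps)
    also have "norm \<dots> \<le> \<bar>m (?r\<^sup>2)\<bar> * norm (C (p - q)) + \<bar>m (?r\<^sup>2) - m (?s\<^sup>2)\<bar> * norm (C q)"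
      by (rule order_trans[OF norm_triangle_ineq]) simp
    also have "\<dots> \<le> K * (norm (p - q) * c) + \<Lambda> * (2 * L * R\<^sup>2 * (norm (p - q) * b))"
    proof (rule add_mono)
      show "\<bar>m (?r\<^sup>2)\<bar> * norm (C (p - q)) \<le> K * (norm (p - q) * c)"
        using bound[of "?r\<^sup>2"] c K by (intro mult_mono) auto
      have "\<bar>m (?r\<^sup>2) - m (?s\<^sup>2)\<bar> * norm (C q) \<le> \<bar>m (?r\<^sup>2) - m (?s\<^sup>2)\<bar> * (\<Lambda> * ?s)"
        using CB by (intro mult_left_mono) auto
      also have "\<dots> = \<Lambda> * (\<bar>m (?r\<^sup>2) - m (?s\<^sup>2)\<bar> * ?s)" by simp
      also have "\<dots> \<le> \<Lambda> * (2 * L * R\<^sup>2 * \<bar>?r - ?s\<bar>)"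
        using cutoff_increment_bound[OF lip L R cutoff, of ?r ?s] \<Lambda> by (intro mult_left_mono) auto
      also have "\<dots> \<le> \<Lambda> * (2 * L * R\<^sup>2 * (norm (p - q) * b))"
      proof (intro mult_left_mono)
        have "\<bar>?r - ?s\<bar> \<le> norm (B p - B q)" by (rule norm_triangle_ineq3)
        also have "B p - B q = B (p - q)" by (simp add: linear_diff[OF bounded_linear.linear[OF B]])
        finally show "\<bar>?r - ?s\<bar> \<le> norm (p - q) * b" using b(2)[of "p - q"] by simp
      qed (use \<Lambda> L in auto)
      finally show "\<bar>m (?r\<^sup>2) - m (?s\<^sup>2)\<bar> * norm (C q) \<le> \<Lambda> * (2 * L * R\<^sup>2 * (norm (p - q) * b))" .
    qed
    finally show ?thesis by (simp add: algebra_simps)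
  qed
  moreover have "0 \<le> K * c + \<Lambda> * (2 * L * R\<^sup>2 * b)" using K b c \<Lambda> L by simp
  ultimately show ?thesis by blast
qed

locale kirchhoff_hilbert = kirchhoff_coefficients l m \<mu> K L + orthonormal_sequence E
  for l m \<mu> K L and E :: "nat \<Rightarrow> 'a::{real_inner, banach}"
begin

text \<open>One state space, the product of two copies of the whole space, serves all \<open>N\<close>: data and forces are
  projected to the first \<open>N\<close> basis vectors, so the other coefficients start at zero and feel no force.\<close>

lemma galerkin_exists:
  assumes R: "0 \<le> R" and cutoff: "\<And>\<sigma>. R\<^sup>2 \<le> \<sigma> \<Longrightarrow> m \<sigma> = m (R\<^sup>2)"
  shows "\<exists>y z. galerkin l m \<mu> K L N y z \<and> (\<forall>i<N. y i 0 = p0 \<bullet> E i \<and> z i 0 = q0 \<bullet> E i)"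
proof -
  define B where "B = (\<lambda>p. \<Sum>j<N. (l j * (p \<bullet> E j)) *\<^sub>R E j)"
  define C where "C = (\<lambda>p. \<Sum>j<N. ((l j)\<^sup>2 * (p \<bullet> E j)) *\<^sub>R E j)"
  have B: "bounded_linear B" and C: "bounded_linear C" unfolding B_def C_def
    by (rule bounded_linear_sum bounded_linear_scaleR_const bounded_linear_const_mult
        bounded_linear_inner_left)+
  have norm_B: "(norm (B p))\<^sup>2 = (\<Sum>j<N. (l j * (p \<bullet> E j))\<^sup>2)" for p
    unfolding B_def by (rule norm_sum_E) simp
  have l_nonneg: "0 \<le> l j" for j using l_pos[of j] by simp
  have CB: "norm (C p) \<le> l N * norm (B p)" for p
  proof (rule power2_le_imp_le)
    have "(norm (C p))\<^sup>2 = (\<Sum>j<N. ((l j)\<^sup>2 * (p \<bullet> E j))\<^sup>2)"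
      unfolding C_def by (rule norm_sum_E) simp
    also have "\<dots> \<le> (\<Sum>j<N. (l N)\<^sup>2 * (l j * (p \<bullet> E j))\<^sup>2)"
    proof (rule sum_mono)
      fix j assume "j \<in> {..<N}"
      then have "(l j)\<^sup>2 \<le> (l N)\<^sup>2" using l_mono l_nonneg by (intro power_mono) (auto simp: mono_def)
      then have "(l j)\<^sup>2 * (l j * (p \<bullet> E j))\<^sup>2 \<le> (l N)\<^sup>2 * (l j * (p \<bullet> E j))\<^sup>2"
        by (intro mult_right_mono) auto
      then show "((l j)\<^sup>2 * (p \<bullet> E j))\<^sup>2 \<le> (l N)\<^sup>2 * (l j * (p \<bullet> E j))\<^sup>2"
        by (simp add: power2_eq_square mult_ac)
    qed
    also have "\<dots> = (l N * norm (B p))\<^sup>2"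
      by (simp add: power_mult_distrib[of "l N"] norm_B sum_distrib_left)
    finally show "(norm (C p))\<^sup>2 \<le> (l N * norm (B p))\<^sup>2" .
  qed (use l_nonneg in simp)
  have bound: "\<bar>m \<sigma>\<bar> \<le> K" if "0 \<le> \<sigma>" for \<sigma>
    using m_ge[OF that] m_le[OF that] \<mu>_pos by simp
  obtain L' where L': "0 \<le> L'" "\<And>p q. norm (m ((norm (B p))\<^sup>2) *\<^sub>R C p - m ((norm (B q))\<^sup>2) *\<^sub>R C q)
      \<le> L' * norm (p - q)"
    using lipschitz_cutoff_force[OF B C CB m_lip bound L_nonneg R cutoff l_nonneg[of N]] by blast
  define g where "g = (\<lambda>x :: 'a \<times> 'a. (snd x, - (m ((norm (B (fst x)))\<^sup>2) *\<^sub>R C (fst x))))"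
  have g_lip: "norm (g x - g x') \<le> (1 + L') * norm (x - x')" for x x'
  proof -
    have "g x - g x' = (snd (x - x'),
        - (m ((norm (B (fst x)))\<^sup>2) *\<^sub>R C (fst x) - m ((norm (B (fst x')))\<^sup>2) *\<^sub>R C (fst x')))"
      by (simp add: g_def)
    also have "norm \<dots> \<le> norm (snd (x - x'))
        + norm (m ((norm (B (fst x)))\<^sup>2) *\<^sub>R C (fst x) - m ((norm (B (fst x')))\<^sup>2) *\<^sub>R C (fst x'))"
      by (rule order_trans[OF norm_Pair_le]) (simp only: norm_minus_cancel order_refl)
    also have "\<dots> \<le> norm (x - x') + L' * norm (x - x')"
    proof (rule add_mono)
      show "norm (snd (x - x')) \<le> norm (x - x')"
        using norm_snd_le[of "snd (x - x')" "fst (x - x')"] by (simp only: prod.collapse)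
      have "norm (fst x - fst x') \<le> norm (x - x')"
        using norm_fst_le[of "fst (x - x')" "snd (x - x')"] by (simp only: prod.collapse) simp
      then have "L' * norm (fst x - fst x') \<le> L' * norm (x - x')" using L'(1) by (rule mult_left_mono)
      with L'(2)[of "fst x" "fst x'"]
      show "norm (m ((norm (B (fst x)))\<^sup>2) *\<^sub>R C (fst x) - m ((norm (B (fst x')))\<^sup>2) *\<^sub>R C (fst x'))
          \<le> L' * norm (x - x')" by (rule order_trans)
    qed
    finally show ?thesis by (simp add: algebra_simps)
  qed
  have "0 < 1 + L'" using L'(1) by simp
  from lipschitz_ode_halfline[OF this g_lip,
      of "((\<Sum>i<N. (p0 \<bullet> E i) *\<^sub>R E i), (\<Sum>i<N. (q0 \<bullet> E i) *\<^sub>R E i))"]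
  obtain x where x0: "x 0 = ((\<Sum>i<N. (p0 \<bullet> E i) *\<^sub>R E i), (\<Sum>i<N. (q0 \<bullet> E i) *\<^sub>R E i))"
    and x: "\<And>t. 0 \<le> t \<Longrightarrow> (x has_vector_derivative g (x t)) (at t within {0..})"
    by (elim exE conjE) simp
  define y z where "y = (\<lambda>i t. fst (x t) \<bullet> E i)" and "z = (\<lambda>i t. snd (x t) \<bullet> E i)"
  have y': "(y i has_real_derivative z i t) (at t within {0..})" if "0 \<le> t" for i t
    using bounded_linear.has_vector_derivative[OF
        bounded_linear_compose[OF bounded_linear_inner_left[of "E i"] bounded_linear_fst] x[OF that]]
    by (simp add: has_real_derivative_iff_has_vector_derivative y_def z_def g_def)
  have inner_C: "C p \<bullet> E i = (if i < N then (l i)\<^sup>2 * (p \<bullet> E i) else 0)" for p i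
    unfolding C_def by (subst inner_sum_E) auto
  have z'': "(z i has_real_derivative - (m ((norm (B (fst (x t))))\<^sup>2) * (C (fst (x t)) \<bullet> E i)))
      (at t within {0..})" if "0 \<le> t" for i t
    using bounded_linear.has_vector_derivative[OF
        bounded_linear_compose[OF bounded_linear_inner_left[of "E i"] bounded_linear_snd] x[OF that]]
    by (simp add: has_real_derivative_iff_has_vector_derivative z_def g_def)
  have init: "y i 0 = (if i < N then p0 \<bullet> E i else 0)" "z i 0 = (if i < N then q0 \<bullet> E i else 0)" for i
    unfolding y_def z_def x0 by (simp_all add: inner_sum_E)
  have z_zero: "z i t = 0" if "N \<le> i" "0 \<le> t" for i t
    using constant_halfline[of "z i" t] z''[of _ i] that by (simp add: inner_C init)
  have y_zero: "y i t = 0" if "N \<le> i" "0 \<le> t" for i t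
    using constant_halfline[of "y i" t] y'[of _ i] that z_zero by (simp add: init)
  have "galerkin l m \<mu> K L N y z"
  proof
    fix t :: real and i assume t: "0 \<le> t"
    show "(y i has_real_derivative z i t) (at t within {0..})" by (rule y'[OF t])
    have "m ((norm (B (fst (x t))))\<^sup>2) * (C (fst (x t)) \<bullet> E i) = (l i)\<^sup>2 * m (\<Sum>j<N. (l j * y j t)\<^sup>2) * y i t"
      using y_zero[of i t] t by (simp add: norm_B inner_C y_def)
    with z''[OF t, of i]
    show "(z i has_real_derivative - ((l i)\<^sup>2 * m (\<Sum>j<N. (l j * y j t)\<^sup>2) * y i t)) (at t within {0..})"
      by simp
  qed (use y_zero z_zero in auto)
  with init show ?thesis by (intro exI[of _ y] exI[of _ z]) auto
qed

end

section \<open>Passage to infinitely many modes\<close>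

text \<open>The equation written mode by mode, now with all modes.  The uniformly small tails are what makes the
  series of modes continuous in time in the energy space.\<close>

locale global_modes = kirchhoff_coefficients +
  fixes y z :: "nat \<Rightarrow> real \<Rightarrow> real"
  assumes y_deriv: "0 \<le> t \<Longrightarrow> (y i has_real_derivative z i t) (at t within {0..})"
    and z_deriv: "0 \<le> t \<Longrightarrow> (z i has_real_derivative
          - ((l i)\<^sup>2 * m (\<Sum>j. (l j * y j t)\<^sup>2) * y i t)) (at t within {0..})"
    and tails: "0 \<le> T \<Longrightarrow> 0 < \<epsilon> \<Longrightarrow>
          \<exists>k. \<forall>t\<in>{0..T}. \<forall>n. (\<Sum>i=k..<n. (l i * y i t)\<^sup>2 + (z i t)\<^sup>2) \<le> \<epsilon>"
    and energy: "0 \<le> t \<Longrightarrow> (\<Sum>i. (z i t)\<^sup>2) + M (\<Sum>i. (l i * y i t)\<^sup>2)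
          = (\<Sum>i. (z i 0)\<^sup>2) + M (\<Sum>i. (l i * y i 0)\<^sup>2)"

context kirchhoff_coefficients
begin

context
  fixes Y Z :: "nat \<Rightarrow> nat \<Rightarrow> real \<Rightarrow> real" and a b :: "nat \<Rightarrow> real" and D :: real
  assumes gal: "\<And>N. galerkin l m \<mu> K L N (Y N) (Z N)"
    and init: "\<And>N i. i < N \<Longrightarrow> Y N i 0 = a i" "\<And>N i. i < N \<Longrightarrow> Z N i 0 = b i"
    and data: "\<And>n. (\<Sum>i<n. (l i * a i)\<^sup>2 + (b i)\<^sup>2) \<le> D"
    and lacunary: "infinite {k. 1 \<le> k \<and> (\<forall>n. (\<Sum>i=k..<n. (l i * a i)\<^sup>2 + (b i)\<^sup>2)
                      * ((real k)\<^sup>2 * exp (real k * l (k - 1))) \<le> 1)}"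
begin

lemma D_nonneg: "0 \<le> D"
  using data[of 0] by simp

lemma initial_energy_le: "(\<Sum>i<N. (Z N i 0)\<^sup>2) + M (galerkin.Q l (Y N) N 0) \<le> K * D"
proof -
  interpret galerkin l m \<mu> K L N "Y N" "Z N" by (rule gal)
  have "M (Q N 0) \<le> K * Q N 0" using M_diff_bounds(2)[of 0 "Q N 0"] Q_nonneg by simp
  moreover have "(\<Sum>i<N. (Z N i 0)\<^sup>2) \<le> K * (\<Sum>i<N. (Z N i 0)\<^sup>2)"
    using mult_right_mono[OF K_ge, of "\<Sum>i<N. (Z N i 0)\<^sup>2"] by (simp add: sum_nonneg)
  moreover have "Q N 0 + (\<Sum>i<N. (Z N i 0)\<^sup>2) \<le> D"
    using data[of N] by (simp add: Q_def init sum.distrib)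
  then have "K * (Q N 0 + (\<Sum>i<N. (Z N i 0)\<^sup>2)) \<le> K * D" using K_ge by (intro mult_left_mono) auto
  ultimately show ?thesis by (simp add: distrib_left)
qed

lemma mode_bounds:
  assumes "0 \<le> t"
  shows "\<bar>l i * Y N i t\<bar> \<le> 1 + K * D / \<mu>" and "\<bar>Z N i t\<bar> \<le> 1 + K * D"
proof -
  interpret galerkin l m \<mu> K L N "Y N" "Z N" by (rule gal)
  \<comment> \<open>A cruder bound than the square root of \<open>c\<close>, but equally independent of \<open>N\<close>.\<close>
  have abs_le: "\<bar>x\<bar> \<le> 1 + c" if "x\<^sup>2 \<le> c" for x c :: real
  proof -
    have "2 * \<bar>x\<bar> * 1 \<le> \<bar>x\<bar>\<^sup>2 + 1\<^sup>2" by (rule sum_squares_bound)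
    moreover have "0 \<le> \<bar>x\<bar>" by simp
    ultimately show ?thesis using that by (simp only: power2_abs power_one)
  qed
  have KD: "0 \<le> K * D" "0 \<le> K * D / \<mu>" using K_ge D_nonneg \<mu>_pos by auto
  note bounds = energy_bounds[OF initial_energy_le assms]
  have "(l i * Y N i t)\<^sup>2 \<le> K * D / \<mu> \<and> (Z N i t)\<^sup>2 \<le> K * D"
  proof (cases "i < N")
    case True
    then have "(l i * Y N i t)\<^sup>2 \<le> Q N t" "(Z N i t)\<^sup>2 \<le> (\<Sum>i<N. (Z N i t)\<^sup>2)"
      unfolding Q_def by (auto intro!: member_le_sum)
    with bounds show ?thesis by linarith
  next
    case False
    then show ?thesis using KD assms by (simp add: y_zero z_zero)
  qed
  then show "\<bar>l i * Y N i t\<bar> \<le> 1 + K * D / \<mu>" and "\<bar>Z N i t\<bar> \<le> 1 + K * D" by (auto intro: abs_le)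
qed

lemma force_bound:
  assumes "0 \<le> t"
  shows "\<bar>- ((l i)\<^sup>2 * m (\<Sum>j<N. (l j * Y N j t)\<^sup>2) * Y N i t)\<bar> \<le> l i * K * (1 + K * D / \<mu>)"
proof -
  define c where "c = m (\<Sum>j<N. (l j * Y N j t)\<^sup>2)"
  have c: "0 \<le> c" "c \<le> K"
    using m_ge[of "\<Sum>j<N. (l j * Y N j t)\<^sup>2"] m_le[of "\<Sum>j<N. (l j * Y N j t)\<^sup>2"] \<mu>_pos
    by (auto simp: c_def sum_nonneg)
  have "\<bar>- ((l i)\<^sup>2 * c * Y N i t)\<bar> = l i * c * \<bar>l i * Y N i t\<bar>"
    using c l_pos[of i] by (simp add: abs_mult power2_eq_square)
  also have "\<dots> \<le> l i * K * (1 + K * D / \<mu>)"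
    using c l_pos[of i] mode_bounds(1)[OF assms] K_ge by (intro mult_mono) auto
  finally show ?thesis by (simp add: c_def)
qed

text \<open>Up to a constant, until time \<open>T\<close> the tail beyond a lacunary index \<open>k\<close> grows at most by the
  factor \<open>exp (c T l (k - 1))\<close>, and for \<open>k \<ge> c T\<close> the smallness \<open>exp (- k l (k - 1))\<close> of the
  initial tail absorbs it.  None of the constants depends on the number of modes.\<close>

lemma galerkin_tails:
  assumes T: "0 \<le> T" and \<epsilon>: "0 < \<epsilon>"
  shows "\<exists>k. \<forall>N. \<forall>t\<in>{0..T}. \<forall>n. (\<Sum>i=k..<n. (l i * Y N i t)\<^sup>2 + (Z N i t)\<^sup>2) \<le> \<epsilon>"
proof -
  define c where "c = L / \<mu> * (K * D + K * D / \<mu>)"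
  define C where "C = (1 + 1 / \<mu>) * K"
  have c: "0 \<le> c" using L_nonneg \<mu>_pos K_ge D_nonneg by (simp add: c_def)
  have C: "0 \<le> C" using \<mu>_pos K_ge by (simp add: C_def)
  obtain k0 :: nat where k0: "max (c * T) (C / \<epsilon>) \<le> real k0" using real_arch_simple by blast
  obtain k where "k0 \<le> k" and k: "1 \<le> k"
    and lac: "\<And>n. (\<Sum>i=k..<n. (l i * a i)\<^sup>2 + (b i)\<^sup>2) * ((real k)\<^sup>2 * exp (real k * l (k - 1))) \<le> 1"
    using lacunary unfolding infinite_nat_iff_unbounded_le by blast
  then have kT: "c * T \<le> real k" and k\<epsilon>: "C / \<epsilon> \<le> real k" using k0 by auto
  have "(\<Sum>i=k..<n. (l i * Y N i t)\<^sup>2 + (Z N i t)\<^sup>2) \<le> \<epsilon>" if t: "t \<in> {0..T}" for N t n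
  proof -
    interpret galerkin l m \<mu> K L N "Y N" "Z N" by (rule gal)
    define S where "S = (\<Sum>i=k..<N. (l i * Y N i 0)\<^sup>2 + (Z N i 0)\<^sup>2)"
    have S: "S = (\<Sum>i=k..<N. (l i * a i)\<^sup>2 + (b i)\<^sup>2)" by (simp add: S_def init)
    have S0: "0 \<le> S" by (simp add: S_def sum_nonneg)
    have "c * t \<le> real k" using mult_left_mono[of t T c] t c kT by simp
    then have "c * l (k - 1) * t \<le> real k * l (k - 1)"
      using mult_right_mono[of "c * t" "real k" "l (k - 1)"] l_pos[of "k - 1"] by (simp add: mult_ac)
    then have "S * exp (c * l (k - 1) * t) \<le> S * exp (real k * l (k - 1))"
      using S0 by (intro mult_left_mono) auto
    also have "\<dots> \<le> 1 / (real k)\<^sup>2"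
      using lac[of N] k by (simp add: S field_simps)
    also have "\<dots> \<le> 1 / real k"
      using k by (simp add: power2_eq_square field_simps)
    finally have "C * (S * exp (c * l (k - 1) * t)) \<le> C * (1 / real k)" using C by (rule mult_left_mono)
    also have "\<dots> \<le> \<epsilon>" using k\<epsilon> \<epsilon> k by (simp add: field_simps)
    finally have "C * S * exp (c * l (k - 1) * t) \<le> \<epsilon>" by (simp add: mult.assoc)
    moreover have "(\<Sum>i=k..<n. (l i * Y N i t)\<^sup>2 + (Z N i t)\<^sup>2) \<le> C * S * exp (c * l (k - 1) * t)"
      using tail_bound[OF initial_energy_le k, of t n] t by (simp add: C_def S_def c_def)
    ultimately show ?thesis by linarith
  qed
  then show ?thesis by blast
qed

lemma lipschitz_modes:
  assumes "0 \<le> s" "0 \<le> t"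
  shows "\<bar>Y N i s - Y N i t\<bar> \<le> (1 + K * D) * \<bar>s - t\<bar>"
    and "\<bar>Z N i s - Z N i t\<bar> \<le> l i * K * (1 + K * D / \<mu>) * \<bar>s - t\<bar>"
  by (rule lipschitz_halfline[OF galerkin.y_deriv[OF gal] mode_bounds(2) assms], assumption, assumption)
     (rule lipschitz_halfline[OF galerkin.z_deriv[OF gal] force_bound assms])

text \<open>A diagonal argument over all modes and all rational times; the modes are scaled by their frequencies
  because this is the form in which the energy bounds them all by one constant.  Equi-Lipschitz continuity
  in time, with a constant depending on the mode, extends the convergence to real times.\<close>

lemma convergent_subsequence:
  obtains r y z where "strict_mono (r :: nat \<Rightarrow> nat)"
    "\<And>i t. 0 \<le> t \<Longrightarrow> (\<lambda>n. Y (r n) i t) \<longlonglongrightarrow> y i t" "\<And>i t. 0 \<le> t \<Longrightarrow> (\<lambda>n. Z (r n) i t) \<longlonglongrightarrow> z i t"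
proof -
  define f where "f = (\<lambda>N (i, q). (l i * Y N i q, Z N i q))"
  have bound: "norm (f N p) \<le> (1 + K * D / \<mu>) + (1 + K * D)" if p_in: "p \<in> UNIV \<times> (\<rat> \<inter> {0..})" for N p
  proof -
    obtain i q where p: "p = (i, q)" "0 \<le> q" using p_in by auto
    show ?thesis unfolding f_def p prod.case
      using mode_bounds[OF p(2)] by (intro order_trans[OF norm_Pair_le] add_mono) auto
  qed
  have "countable (UNIV \<times> (\<rat> \<inter> {0..}) :: (nat \<times> real) set)"
    by (intro countable_SIGMA) (auto intro: countable_rat)
  then obtain r where r: "strict_mono (r :: nat \<Rightarrow> nat)"
    "\<And>p. p \<in> UNIV \<times> (\<rat> \<inter> {0..}) \<Longrightarrow> \<exists>v. (\<lambda>n. f (r n) p) \<longlonglongrightarrow> v"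
    by (rule function_convergent_subsequence[where f = f, OF _ bound]) (assumption, rule that)
  have rat: "convergent (\<lambda>n. Y (r n) i q)" "convergent (\<lambda>n. Z (r n) i q)"
    if q: "q \<in> \<rat>" "0 \<le> q" for i q
  proof -
    obtain v where v: "(\<lambda>n. (l i * Y (r n) i q, Z (r n) i q)) \<longlonglongrightarrow> v"
      using r(2)[of "(i, q)"] q by (auto simp: f_def)
    have "(\<lambda>n. l i * Y (r n) i q / l i) \<longlonglongrightarrow> fst v / l i"
      using tendsto_fst[OF v] l_pos[of i] by (intro tendsto_divide) auto
    then show "convergent (\<lambda>n. Y (r n) i q)" using l_pos[of i] by (auto simp: convergent_def)
    show "convergent (\<lambda>n. Z (r n) i q)" using tendsto_snd[OF v] by (auto simp: convergent_def)
  qed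
  have "convergent (\<lambda>n. Y (r n) i t)" "convergent (\<lambda>n. Z (r n) i t)" if "0 \<le> t" for i t
    using convergent_if_lipschitz_convergent_on_Rats[of "\<lambda>n. Y (r n) i", OF lipschitz_modes(1) rat(1) that]
      convergent_if_lipschitz_convergent_on_Rats[of "\<lambda>n. Z (r n) i", OF lipschitz_modes(2) rat(2) that]
    by auto
  then show thesis
    by (intro that[OF r(1), of "\<lambda>i t. lim (\<lambda>n. Y (r n) i t)" "\<lambda>i t. lim (\<lambda>n. Z (r n) i t)"])
       (auto simp: convergent_LIMSEQ_iff)
qed

text \<open>The coupling \<open>m (\<Sum>j. (l j * y j t)\<^sup>2)\<close> involves all modes at once, so convergence of each mode is not
  enough: the uniformly small tails give convergence of the whole sum, both here and in the energy.\<close>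

lemma global_modes_exist:
  "\<exists>y z. global_modes l m \<mu> K L y z \<and> (\<forall>i. y i 0 = a i) \<and> (\<forall>i. z i 0 = b i)"
proof -
  obtain r y z where r: "strict_mono r"
    and limY: "\<And>i t. 0 \<le> t \<Longrightarrow> (\<lambda>n. Y (r n) i t) \<longlonglongrightarrow> y i t"
    and limZ: "\<And>i t. 0 \<le> t \<Longrightarrow> (\<lambda>n. Z (r n) i t) \<longlonglongrightarrow> z i t"
    by (rule convergent_subsequence) (rule that)
  have initial: "y i 0 = a i" "z i 0 = b i" for i
  proof -
    have ev: "\<forall>\<^sub>F n in sequentially. i < r n"
      using eventually_gt_at_top[of i] by eventually_elim (use seq_suble[OF r] less_le_trans in blast)
    have "(\<lambda>n. Y (r n) i 0) \<longlonglongrightarrow> a i" "(\<lambda>n. Z (r n) i 0) \<longlonglongrightarrow> b i"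
      using ev by (auto intro!: tendsto_eventually elim!: eventually_mono simp: init)
    then show "y i 0 = a i" "z i 0 = b i" using limY[of 0 i] limZ[of 0 i] LIMSEQ_unique by auto
  qed
  have cont: "continuous_on {0..} (y i)" "continuous_on {0..} (z i)" for i
    by (rule continuous_on_limit_lipschitz[OF lipschitz_modes(1) limY], assumption+,
        rule continuous_on_limit_lipschitz[OF lipschitz_modes(2) limZ])
  have tails: "\<exists>k. \<forall>t\<in>{0..T}. \<forall>n. (\<Sum>i=k..<n. (l i * y i t)\<^sup>2 + (z i t)\<^sup>2) \<le> \<epsilon>"
    if T\<epsilon>: "0 \<le> T" "0 < \<epsilon>" for T \<epsilon>
  proof -
    obtain k where k: "\<And>N t n. t \<in> {0..T} \<Longrightarrow> (\<Sum>i=k..<n. (l i * Y N i t)\<^sup>2 + (Z N i t)\<^sup>2) \<le> \<epsilon>"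
      using galerkin_tails[OF T\<epsilon>] by blast
    have "(\<Sum>i=k..<n. (l i * y i t)\<^sup>2 + (z i t)\<^sup>2) \<le> \<epsilon>" if t: "t \<in> {0..T}" for t n
    proof (rule LIMSEQ_le_const2)
      show "(\<lambda>N. \<Sum>i=k..<n. (l i * Y (r N) i t)\<^sup>2 + (Z (r N) i t)\<^sup>2)
          \<longlonglongrightarrow> (\<Sum>i=k..<n. (l i * y i t)\<^sup>2 + (z i t)\<^sup>2)"
        using t by (intro tendsto_intros limY limZ) auto
    qed (use k[OF t] in auto)
    then show ?thesis by blast
  qed
  \<comment> \<open>Either half of a tail is bounded by the whole tail.\<close>
  have half: "norm (\<Sum>i\<in>I. (p i)\<^sup>2) \<le> \<epsilon>" "norm (\<Sum>i\<in>I. (q i)\<^sup>2) \<le> \<epsilon>"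
    if "(\<Sum>i\<in>I. (p i)\<^sup>2 + (q i)\<^sup>2) \<le> \<epsilon>" for I and p q :: "nat \<Rightarrow> real" and \<epsilon>
    using that sum_nonneg[of I "\<lambda>i. (p i)\<^sup>2"] sum_nonneg[of I "\<lambda>i. (q i)\<^sup>2"] by (auto simp: sum.distrib)
  have finite_sums: "(\<Sum>j. (l j * Y N j t)\<^sup>2) = (\<Sum>j<N. (l j * Y N j t)\<^sup>2)"
      "(\<Sum>j. (Z N j t)\<^sup>2) = (\<Sum>j<N. (Z N j t)\<^sup>2)" if "0 \<le> t" for N t
    by (rule suminf_finite; use galerkin.y_zero[OF gal that] galerkin.z_zero[OF gal that] in simp)+
  have limQ: "(\<lambda>n. \<Sum>j<r n. (l j * Y (r n) j t)\<^sup>2) \<longlonglongrightarrow> (\<Sum>j. (l j * y j t)\<^sup>2)" if t: "0 \<le> t" for t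
    unfolding finite_sums(1)[OF t, symmetric]
  proof (rule tendsto_suminf_small_tails[where X = UNIV])
    show "(\<lambda>n. (l i * Y (r n) i t)\<^sup>2) \<longlonglongrightarrow> (l i * y i t)\<^sup>2" for i by (intro tendsto_intros limY t)
    fix \<epsilon> :: real assume "0 < \<epsilon>"
    from galerkin_tails[OF t this] obtain k
      where "\<And>N n. (\<Sum>i=k..<n. (l i * Y N i t)\<^sup>2 + (Z N i t)\<^sup>2) \<le> \<epsilon>" using t by force
    then show "\<exists>k. \<forall>n\<in>UNIV. \<forall>p. norm (\<Sum>j=k..<p. (l j * Y (r n) j t)\<^sup>2) \<le> \<epsilon>"
      by (intro exI[of _ k] ballI allI half(1))
  qed simp
  have limV: "(\<lambda>n. \<Sum>j<r n. (Z (r n) j t)\<^sup>2) \<longlonglongrightarrow> (\<Sum>j. (z j t)\<^sup>2)" if t: "0 \<le> t" for t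
    unfolding finite_sums(2)[OF t, symmetric]
  proof (rule tendsto_suminf_small_tails[where X = UNIV])
    show "(\<lambda>n. (Z (r n) i t)\<^sup>2) \<longlonglongrightarrow> (z i t)\<^sup>2" for i by (intro tendsto_intros limZ t)
    fix \<epsilon> :: real assume "0 < \<epsilon>"
    from galerkin_tails[OF t this] obtain k
      where "\<And>N n. (\<Sum>i=k..<n. (l i * Y N i t)\<^sup>2 + (Z N i t)\<^sup>2) \<le> \<epsilon>" using t by force
    then show "\<exists>k. \<forall>n\<in>UNIV. \<forall>p. norm (\<Sum>j=k..<p. (Z (r n) j t)\<^sup>2) \<le> \<epsilon>"
      by (intro exI[of _ k] ballI allI half(2))
  qed simp
  define Q where "Q = (\<lambda>t. \<Sum>j. (l j * y j t)\<^sup>2)"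
  have contQ: "continuous_on {0..} Q"
    unfolding Q_def
  proof (rule continuous_on_suminf_small_tails)
    show "continuous_on {0..} (\<lambda>t. (l i * y i t)\<^sup>2)" for i by (intro continuous_intros cont)
    fix T \<epsilon> :: real assume "0 \<le> T" "0 < \<epsilon>"
    from tails[OF this] obtain k
      where "\<And>t n. t \<in> {0..T} \<Longrightarrow> (\<Sum>i=k..<n. (l i * y i t)\<^sup>2 + (z i t)\<^sup>2) \<le> \<epsilon>" by blast
    then show "\<exists>k. \<forall>t\<in>{0..T}. \<forall>n. norm (\<Sum>i=k..<n. (l i * y i t)\<^sup>2) \<le> \<epsilon>"
      by (intro exI[of _ k] ballI allI half(1))
  qed
  have Q_nonneg: "0 \<le> Q t" if "0 \<le> t" for t
    using limQ[OF that] unfolding Q_def by (rule LIMSEQ_le_const) (simp add: sum_nonneg)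
  have lim_m: "(\<lambda>n. m (\<Sum>j<r n. (l j * Y (r n) j t)\<^sup>2)) \<longlonglongrightarrow> m (Q t)"
   and lim_M: "(\<lambda>n. M (\<Sum>j<r n. (l j * Y (r n) j t)\<^sup>2)) \<longlonglongrightarrow> M (Q t)" if t: "0 \<le> t" for t
    using limQ[OF t] Q_nonneg[OF t] unfolding Q_def
    by (auto intro!: continuous_on_tendsto_compose[OF continuous_m]
        continuous_on_tendsto_compose[OF continuous_M] simp: sum_nonneg)
  have "global_modes l m \<mu> K L y z"
  proof
    fix t :: real and i assume t: "0 \<le> t"
    show "(y i has_real_derivative z i t) (at t within {0..})"
      by (rule has_real_derivative_limit_halfline[OF galerkin.y_deriv[OF gal] mode_bounds(2) limY limZ cont(2) t])
    show "(z i has_real_derivative - ((l i)\<^sup>2 * m (\<Sum>j. (l j * y j t)\<^sup>2) * y i t)) (at t within {0..})"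
      unfolding Q_def[symmetric, THEN fun_cong]
    proof (rule has_real_derivative_limit_halfline[OF galerkin.z_deriv[OF gal] force_bound limZ _ _ t])
      show "(\<lambda>n. - ((l i)\<^sup>2 * m (\<Sum>j<r n. (l j * Y (r n) j s)\<^sup>2) * Y (r n) i s))
          \<longlonglongrightarrow> - ((l i)\<^sup>2 * m (Q s) * y i s)" if "0 \<le> s" for s
        by (intro tendsto_intros lim_m limY that)
      have "continuous_on {0..} (\<lambda>s. m (Q s))"
        by (rule continuous_on_compose2[OF continuous_m contQ]) (auto intro: Q_nonneg)
      then show "continuous_on {0..} (\<lambda>s. - ((l i)\<^sup>2 * m (Q s) * y i s))"
        by (intro continuous_intros cont)
    qed
    have lim_energy: "(\<lambda>n. (\<Sum>j<r n. (Z (r n) j s)\<^sup>2) + M (\<Sum>j<r n. (l j * Y (r n) j s)\<^sup>2))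
        \<longlonglongrightarrow> (\<Sum>i. (z i s)\<^sup>2) + M (Q s)" if "0 \<le> s" for s
      by (intro tendsto_add limV lim_M that)
    have "(\<Sum>j<N. (Z N j t)\<^sup>2) + M (\<Sum>j<N. (l j * Y N j t)\<^sup>2)
        = (\<Sum>j<N. (Z N j 0)\<^sup>2) + M (\<Sum>j<N. (l j * Y N j 0)\<^sup>2)" for N
      using galerkin.energy_conserved[OF gal t, of N] by (simp add: galerkin.Q_def[OF gal])
    with lim_energy[OF t]
    have "(\<lambda>n. (\<Sum>j<r n. (Z (r n) j 0)\<^sup>2) + M (\<Sum>j<r n. (l j * Y (r n) j 0)\<^sup>2))
        \<longlonglongrightarrow> (\<Sum>i. (z i t)\<^sup>2) + M (Q t)" by simp
    from LIMSEQ_unique[OF this lim_energy[OF order_refl]]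
    show "(\<Sum>i. (z i t)\<^sup>2) + M (\<Sum>i. (l i * y i t)\<^sup>2) = (\<Sum>i. (z i 0)\<^sup>2) + M (\<Sum>i. (l i * y i 0)\<^sup>2)"
      by (simp add: Q_def)
  qed (rule tails)
  with initial show ?thesis by blast
qed

end

end

section \<open>Expansions in an orthonormal sequence\<close>

context orthonormal_sequence
begin

lemma norm_sum_E_le:
  assumes "(\<Sum>i\<in>I. (c i)\<^sup>2) \<le> \<epsilon>\<^sup>2" "0 \<le> \<epsilon>" "finite I"
  shows "norm (\<Sum>i\<in>I. c i *\<^sub>R E i) \<le> \<epsilon>"
  by (rule power2_le_imp_le[OF _ assms(2)]) (simp only: norm_sum_E[OF assms(3)] assms(1))

lemma summable_E:
  assumes "summable (\<lambda>i. (c i)\<^sup>2)"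
  shows "summable (\<lambda>i. c i *\<^sub>R E i)"
proof (rule summable_if_small_tails)
  fix \<epsilon> :: real assume \<epsilon>: "0 < \<epsilon>"
  then have "0 < \<epsilon>\<^sup>2" by simp
  with assms obtain k where "\<And>n. norm (\<Sum>i=k..<n. (c i)\<^sup>2) < \<epsilon>\<^sup>2"
    unfolding summable_Cauchy by blast
  then have "(\<Sum>i=k..<n. (c i)\<^sup>2) \<le> \<epsilon>\<^sup>2" for n
    using abs_le_D1 less_imp_le real_norm_def by metis
  then show "\<exists>k. \<forall>n. norm (\<Sum>i=k..<n. c i *\<^sub>R E i) \<le> \<epsilon>"
    using \<epsilon> by (intro exI[of _ k] allI norm_sum_E_le) auto
qed

lemma inner_suminf_E:
  assumes "summable (\<lambda>i. (c i)\<^sup>2)"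
  shows "(\<Sum>i. c i *\<^sub>R E i) \<bullet> E j = c j"
proof -
  have "(\<Sum>i. c i *\<^sub>R E i) \<bullet> E j = (\<Sum>i. (c i *\<^sub>R E i) \<bullet> E j)"
    by (rule bounded_linear.suminf[OF bounded_linear_inner_left summable_E[OF assms]])
  also have "\<dots> = (\<Sum>i\<in>{j}. (c i *\<^sub>R E i) \<bullet> E j)"
    by (rule suminf_finite) (auto simp: inner_E)
  finally show ?thesis by (simp add: inner_E)
qed

lemma norm_suminf_E:
  assumes "summable (\<lambda>i. (c i)\<^sup>2)"
  shows "(norm (\<Sum>i. c i *\<^sub>R E i))\<^sup>2 = (\<Sum>i. (c i)\<^sup>2)"
proof -
  have "(\<lambda>n. (norm (\<Sum>i<n. c i *\<^sub>R E i))\<^sup>2) \<longlonglongrightarrow> (norm (\<Sum>i. c i *\<^sub>R E i))\<^sup>2"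
    by (intro tendsto_intros summable_LIMSEQ summable_E assms)
  then have "(\<lambda>n. \<Sum>i<n. (c i)\<^sup>2) \<longlonglongrightarrow> (norm (\<Sum>i. c i *\<^sub>R E i))\<^sup>2"
    by (simp add: norm_sum_E)
  then show ?thesis using summable_LIMSEQ[OF assms] by (rule LIMSEQ_unique)
qed

lemma inner_sum_E_left: "(\<Sum>i\<in>I. c i *\<^sub>R E i) \<bullet> x = (\<Sum>i\<in>I. c i * (x \<bullet> E i))"
  unfolding inner_sum_left by (rule sum.cong) (simp_all add: inner_commute)

lemma inner_suminf_LIMSEQ:
  assumes "summable (\<lambda>i. (c i)\<^sup>2)"
  shows "(\<lambda>n. \<Sum>i<n. c i * (x \<bullet> E i)) \<longlonglongrightarrow> (\<Sum>i. c i *\<^sub>R E i) \<bullet> x"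
proof -
  have "(\<lambda>n. (\<Sum>i<n. c i *\<^sub>R E i) \<bullet> x) \<longlonglongrightarrow> (\<Sum>i. c i *\<^sub>R E i) \<bullet> x"
    by (intro tendsto_intros summable_LIMSEQ summable_E assms)
  then show ?thesis by (simp only: inner_sum_E_left)
qed

lemma abs_inner_partial_sum_le:
  assumes "summable (\<lambda>i. (c i)\<^sup>2)"
  shows "\<bar>\<Sum>i<n. c i * (x \<bullet> E i)\<bar> \<le> norm (\<Sum>i. c i *\<^sub>R E i) * norm x"
proof -
  have "(\<Sum>i<n. (c i)\<^sup>2) \<le> (\<Sum>i. (c i)\<^sup>2)" using assms by (intro sum_le_suminf) auto
  then have "norm (\<Sum>i<n. c i *\<^sub>R E i) \<le> norm (\<Sum>i. c i *\<^sub>R E i)"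
    by (intro norm_sum_E_le) (simp_all add: norm_suminf_E[OF assms])
  moreover have "\<bar>\<Sum>i<n. c i * (x \<bullet> E i)\<bar> \<le> norm (\<Sum>i<n. c i *\<^sub>R E i) * norm x"
    using Cauchy_Schwarz_ineq2[of "\<Sum>i<n. c i *\<^sub>R E i" x] by (simp only: inner_sum_E_left)
  ultimately show ?thesis by (meson mult_right_mono norm_ge_zero order_trans)
qed

lemma bessel: "(\<Sum>i<n. (x \<bullet> E i)\<^sup>2) \<le> (norm x)\<^sup>2"
proof -
  let ?p = "\<Sum>i<n. (x \<bullet> E i) *\<^sub>R E i"
  have "x \<bullet> ?p = (\<Sum>i<n. (x \<bullet> E i)\<^sup>2)" by (simp add: inner_sum_right power2_eq_square)
  moreover have "?p \<bullet> ?p = (\<Sum>i<n. (x \<bullet> E i)\<^sup>2)" by (simp add: norm_sum_E flip: power2_norm_eq_inner)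
  moreover have "0 \<le> (x - ?p) \<bullet> (x - ?p)" by simp
  ultimately show ?thesis
    by (simp only: inner_diff_left inner_diff_right inner_commute[of ?p x] power2_norm_eq_inner)
qed

lemma summable_bessel: "summable (\<lambda>i. (x \<bullet> E i)\<^sup>2)"
  using bessel by (intro summableI_nonneg_bounded[where x = "(norm x)\<^sup>2"]) auto

end

text \<open>The basis and the frequencies are indexed by the positive integers, the modes by all natural
  numbers; hence the successors.\<close>

locale orthonormal_eigenbasis = orthonormal_sequence "\<lambda>i. e (Suc i)"
  for e :: "nat \<Rightarrow> 'a::{real_inner, banach}" and lam :: "nat \<Rightarrow> real" +
  assumes complete: "(\<And>i. v \<bullet> e (Suc i) = 0) \<Longrightarrow> v = 0"
begin

lemma eq_if_inner_eq: "(\<And>i. v \<bullet> e (Suc i) = v' \<bullet> e (Suc i)) \<Longrightarrow> v = v'"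
  using complete[of "v - v'"] by (simp add: inner_diff_left)

lemma dom_half_iff: "v \<in> dom_half e lam \<longleftrightarrow> summable (\<lambda>i. (lam (Suc i) * (v \<bullet> e (Suc i)))\<^sup>2)"
  by (simp add: dom_half_def power_mult_distrib)

lemma A_half_diff:
  assumes "v \<in> dom_half e lam" "v' \<in> dom_half e lam"
  shows "A_half e lam (v - v') = A_half e lam v - A_half e lam v'"
  unfolding A_half_def
  by (subst suminf_diff) (use assms in \<open>auto simp: dom_half_iff inner_diff_left algebra_simps intro: summable_E\<close>)

lemma inner_A_half:
  "v \<in> dom_half e lam \<Longrightarrow> A_half e lam v \<bullet> e (Suc i) = lam (Suc i) * (v \<bullet> e (Suc i))"
  unfolding A_half_def dom_half_iff by (rule inner_suminf_E)

lemma continuous_on_A_half: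
  assumes "C0_dom_half e lam S \<phi>"
  shows "continuous_on S (\<lambda>t. A_half e lam (\<phi> t))"
  unfolding continuous_on_def
proof
  fix t assume t: "t \<in> S"
  have "((\<lambda>s. norm (A_half e lam (\<phi> s) - A_half e lam (\<phi> t))) \<longlongrightarrow> 0) (at t within S)"
  proof (rule Lim_transform_within[OF _ zero_less_one])
    show "((\<lambda>s. norm (A_half e lam (\<phi> s - \<phi> t))) \<longlongrightarrow> 0) (at t within S)"
      using assms t by (simp add: C0_dom_half_def)
  qed (use assms t in \<open>simp add: C0_dom_half_def A_half_diff\<close>)
  then show "((\<lambda>s. A_half e lam (\<phi> s)) \<longlongrightarrow> A_half e lam (\<phi> t)) (at t within S)"
    by (rule Lim_null[THEN iffD2, OF tendsto_norm_zero_cancel])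
qed

end

section \<open>From modes to a weak solution\<close>

lemma vector_derivative_halfline:
  assumes "(u has_vector_derivative u') (at t within {0..})" "0 \<le> t"
  shows "vector_derivative u (at t within {0..}) = u'"
proof (rule vector_derivative_within[OF _ assms(1)])
  have "t islimpt {0..t + 1}" using assms(2) by (simp add: islimpt_Icc)
  then have "t islimpt {0..}" by (rule islimpt_subset) auto
  then show "at t within {0..} \<noteq> bot" by (simp add: trivial_limit_within)
qed

locale mode_solution =
  global_modes "\<lambda>i. lam (Suc i)" m \<mu> K L y z + orthonormal_eigenbasis e lam
  for lam m \<mu> K L y z and e :: "nat \<Rightarrow> 'a::{real_inner, banach}" +
  fixes u0 u1 :: 'a
  assumes y_init: "y i 0 = u0 \<bullet> e (Suc i)" and z_init: "z i 0 = u1 \<bullet> e (Suc i)"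
begin

definition velocity :: "real \<Rightarrow> 'a" where
  "velocity t = (\<Sum>i. z i t *\<^sub>R e (Suc i))"

text \<open>This is \<open>A\<^sup>1\<^sup>/\<^sup>2\<close> applied to the solution.\<close>

definition tension :: "real \<Rightarrow> 'a" where
  "tension t = (\<Sum>i. (lam (Suc i) * y i t) *\<^sub>R e (Suc i))"

text \<open>Defined through its velocity rather than as the series of the \<open>y i t\<close>, so that differentiability
  is immediate; its coefficients are identified afterwards.\<close>

definition solution :: "real \<Rightarrow> 'a" where
  "solution t = u0 + integral {0..t} velocity"

lemma small_tails:
  assumes "0 \<le> T" "0 < \<epsilon>"
  shows "\<exists>k. \<forall>t\<in>{0..T}. \<forall>n. (\<Sum>i=k..<n. (lam (Suc i) * y i t)\<^sup>2) \<le> \<epsilon> \<and> (\<Sum>i=k..<n. (z i t)\<^sup>2) \<le> \<epsilon>"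
proof -
  obtain k where k: "\<And>t n. t \<in> {0..T} \<Longrightarrow> (\<Sum>i=k..<n. (lam (Suc i) * y i t)\<^sup>2 + (z i t)\<^sup>2) \<le> \<epsilon>"
    using tails[OF assms] by blast
  have "(\<Sum>i=k..<n. (lam (Suc i) * y i t)\<^sup>2) \<le> \<epsilon> \<and> (\<Sum>i=k..<n. (z i t)\<^sup>2) \<le> \<epsilon>"
    if "t \<in> {0..T}" for t n
    using k[OF that, of n] sum_nonneg[of "{k..<n}" "\<lambda>i. (lam (Suc i) * y i t)\<^sup>2"]
      sum_nonneg[of "{k..<n}" "\<lambda>i. (z i t)\<^sup>2"] by (simp add: sum.distrib)
  then show ?thesis by blast
qed

lemma summable_modes:
  assumes "0 \<le> t"
  shows "summable (\<lambda>i. (lam (Suc i) * y i t)\<^sup>2)" and "summable (\<lambda>i. (z i t)\<^sup>2)"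
proof -
  have t: "t \<in> {0..t}" using assms by simp
  have "(\<exists>k. \<forall>n. norm (\<Sum>i=k..<n. (lam (Suc i) * y i t)\<^sup>2) \<le> \<epsilon>)
      \<and> (\<exists>k. \<forall>n. norm (\<Sum>i=k..<n. (z i t)\<^sup>2) \<le> \<epsilon>)" if \<epsilon>: "0 < \<epsilon>" for \<epsilon>
  proof -
    obtain k where "\<And>n. (\<Sum>i=k..<n. (lam (Suc i) * y i t)\<^sup>2) \<le> \<epsilon> \<and> (\<Sum>i=k..<n. (z i t)\<^sup>2) \<le> \<epsilon>"
      using small_tails[OF assms \<epsilon>] t by blast
    then show ?thesis by (intro conjI exI[of _ k] allI) (simp_all add: sum_nonneg)
  qed
  then show "summable (\<lambda>i. (lam (Suc i) * y i t)\<^sup>2)" "summable (\<lambda>i. (z i t)\<^sup>2)"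
    by (auto intro: summable_if_small_tails)
qed

lemma continuous_modes: "continuous_on {0..} (y i)" "continuous_on {0..} (z i)"
  by (rule DERIV_continuous_on[OF y_deriv], simp, rule DERIV_continuous_on[OF z_deriv], simp)

lemma continuous_velocity: "continuous_on {0..} velocity"
  and continuous_tension: "continuous_on {0..} tension"
proof -
  have "\<exists>k. \<forall>t\<in>{0..T}. \<forall>n. norm (\<Sum>i=k..<n. (lam (Suc i) * y i t) *\<^sub>R e (Suc i)) \<le> \<epsilon>
        \<and> norm (\<Sum>i=k..<n. z i t *\<^sub>R e (Suc i)) \<le> \<epsilon>" if "0 \<le> T" "0 < \<epsilon>" for T \<epsilon>
  proof -
    have "0 < \<epsilon>\<^sup>2" using that by simp
    from small_tails[OF that(1) this] show ?thesis
      using that(2) norm_sum_E_le less_imp_le by (meson finite_atLeastLessThan)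
  qed
  note small = this
  show "continuous_on {0..} velocity"
    unfolding velocity_def
  proof (rule continuous_on_suminf_small_tails)
    show "continuous_on {0..} (\<lambda>t. z i t *\<^sub>R e (Suc i))" for i
      by (intro continuous_intros continuous_modes)
    show "\<exists>k. \<forall>t\<in>{0..T}. \<forall>n. norm (\<Sum>i=k..<n. z i t *\<^sub>R e (Suc i)) \<le> \<epsilon>"
      if "0 \<le> T" "0 < \<epsilon>" for T \<epsilon> using small[OF that] by meson
  qed
  show "continuous_on {0..} tension"
    unfolding tension_def
  proof (rule continuous_on_suminf_small_tails)
    show "continuous_on {0..} (\<lambda>t. (lam (Suc i) * y i t) *\<^sub>R e (Suc i))" for i
      by (intro continuous_intros continuous_modes)
    show "\<exists>k. \<forall>t\<in>{0..T}. \<forall>n. norm (\<Sum>i=k..<n. (lam (Suc i) * y i t) *\<^sub>R e (Suc i)) \<le> \<epsilon>"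
      if "0 \<le> T" "0 < \<epsilon>" for T \<epsilon> using small[OF that] by meson
  qed
qed

lemma solution_deriv:
  "0 \<le> t \<Longrightarrow> (solution has_vector_derivative velocity t) (at t within {0..})"
  unfolding solution_def [abs_def]
  using integral_has_vector_derivative_halfline[OF continuous_velocity]
  by (auto intro!: derivative_eq_intros)

lemma inner_solution:
  assumes t: "0 \<le> t"
  shows "solution t \<bullet> e (Suc i) = y i t"
proof -
  have int: "velocity integrable_on {0..t}"
    by (intro integrable_continuous_interval continuous_on_subset[OF continuous_velocity]) auto
  have "integral {0..t} velocity \<bullet> e (Suc i) = integral {0..t} (\<lambda>s. velocity s \<bullet> e (Suc i))"
    using integral_linear[OF int bounded_linear_inner_left[of "e (Suc i)"]] by (simp add: o_def)
  also have "\<dots> = integral {0..t} (z i)"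
    by (rule integral_cong) (simp add: velocity_def inner_suminf_E summable_modes)
  also have "\<dots> = y i t - y i 0"
    using y_deriv t by (intro integral_unique has_integral_of_deriv_halfline)
      (simp_all add: has_real_derivative_iff_has_vector_derivative)
  finally show ?thesis by (simp add: solution_def inner_add_left y_init)
qed

lemma solution_dom: "0 \<le> t \<Longrightarrow> solution t \<in> dom_half e lam"
  using summable_modes(1)[of t] by (simp add: dom_half_iff inner_solution)

lemma A_half_solution: "0 \<le> t \<Longrightarrow> A_half e lam (solution t) = tension t"
  by (simp add: A_half_def tension_def inner_solution)

lemma solution_0: "solution 0 = u0"
  by (simp add: solution_def)

lemma velocity_0: "velocity 0 = u1"
proof (rule eq_if_inner_eq)
  have "velocity 0 \<bullet> e (Suc i) = z i 0" for i
    unfolding velocity_def by (rule inner_suminf_E[OF summable_modes(2)[OF order_refl]])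
  then show "velocity 0 \<bullet> e (Suc i) = u1 \<bullet> e (Suc i)" for i by (simp only: z_init)
qed

lemma norm_tension: "0 \<le> t \<Longrightarrow> (norm (tension t))\<^sup>2 = (\<Sum>i. (lam (Suc i) * y i t)\<^sup>2)"
  unfolding tension_def by (intro norm_suminf_E summable_modes)

lemma energy_equality:
  assumes "0 \<le> t"
  shows "(norm (velocity t))\<^sup>2 + M ((norm (tension t))\<^sup>2)
    = (norm u1)\<^sup>2 + M ((norm (A_half e lam u0))\<^sup>2)"
proof -
  have energy_at: "(norm (velocity s))\<^sup>2 + M ((norm (tension s))\<^sup>2)
      = (\<Sum>i. (z i s)\<^sup>2) + M (\<Sum>i. (lam (Suc i) * y i s)\<^sup>2)" if s: "0 \<le> s" for s
    using norm_suminf_E[OF summable_modes(2)[OF s]] norm_tension[OF s] by (simp only: velocity_def)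
  have "tension 0 = A_half e lam u0" using A_half_solution[of 0] by (simp only: solution_0 order_refl)
  with energy_at[OF assms] energy_at[of 0] energy[OF assms] velocity_0 show ?thesis
    by (simp only: order_refl)
qed

lemma solution_C0: "C0_dom_half e lam {0..} solution"
  unfolding C0_dom_half_def
proof (intro conjI ballI)
  fix t :: real assume t: "t \<in> {0..}"
  have "((\<lambda>s. tension s - tension t) \<longlongrightarrow> tension t - tension t) (at t within {0..})"
    using continuous_tension t by (intro tendsto_intros) (simp add: continuous_on_def)
  then have "((\<lambda>s. norm (tension s - tension t)) \<longlongrightarrow> 0) (at t within {0..})"
    using tendsto_norm_zero by fastforce
  then show "((\<lambda>s. norm (A_half e lam (solution s - solution t))) \<longlongrightarrow> 0) (at t within {0..})"
    by (rule Lim_transform_within[OF _ zero_less_one])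
       (use t in \<open>simp add: A_half_diff solution_dom A_half_solution\<close>)
qed (simp add: solution_dom)

text \<open>Each mode satisfies its weak equation by the fundamental theorem of calculus.  The partial
  sums of these equations converge pointwise in time, and by the Cauchy--Schwarz inequality they are
  dominated by norms of continuous functions.\<close>

lemma weak_equation:
  assumes T: "0 < T" and \<phi>0: "C0_dom_half e lam {0..T} \<phi>"
    and \<phi>': "\<And>t. t \<in> {0..T} \<Longrightarrow> (\<phi> has_vector_derivative \<phi>' t) (at t within {0..T})"
    and cont: "continuous_on {0..T} \<phi>'" and ends: "\<phi> 0 = 0" "\<phi> T = 0"
  shows "integral {0..T} (\<lambda>t. velocity t \<bullet> \<phi>' t)
       = integral {0..T} (\<lambda>t. m ((norm (tension t))\<^sup>2) * (tension t \<bullet> A_half e lam (\<phi> t)))"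
proof -
  let ?A = "\<lambda>t. A_half e lam (\<phi> t)"
  define c where "c = (\<lambda>t. m ((norm (tension t))\<^sup>2))"
  have c_bounds: "0 \<le> c t" "c t \<le> K" for t
    using m_ge[of "(norm (tension t))\<^sup>2"] m_le[of "(norm (tension t))\<^sup>2"] \<mu>_pos by (auto simp: c_def)
  have contA: "continuous_on {0..T} ?A" by (rule continuous_on_A_half[OF \<phi>0])
  have contv: "continuous_on {0..T} velocity" and contw: "continuous_on {0..T} tension"
    by (rule continuous_on_subset[OF continuous_velocity], force,
        rule continuous_on_subset[OF continuous_tension], force)
  have contc: "continuous_on {0..T} c"
    unfolding c_def
    by (rule continuous_on_compose2[OF continuous_m]) (auto intro!: continuous_intros contw)
  define f where "f = (\<lambda>n t. (\<Sum>i<n. z i t * (\<phi>' t \<bullet> e (Suc i)))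
      - c t * (\<Sum>i<n. (lam (Suc i) * y i t) * (?A t \<bullet> e (Suc i))))"
  have f_int: "(f n has_integral 0) {0..T}" for n
  proof -
    have "((\<lambda>t. z i t * (\<phi>' t \<bullet> e (Suc i)) - c t * ((lam (Suc i) * y i t) * (?A t \<bullet> e (Suc i))))
        has_integral 0) {0..T}" for i
    proof -
      have "((\<lambda>t. z i t * (\<phi>' t \<bullet> e (Suc i)) - c t * ((lam (Suc i) * y i t) * (?A t \<bullet> e (Suc i))))
        has_integral (z i T * (\<phi> T \<bullet> e (Suc i)) - z i 0 * (\<phi> 0 \<bullet> e (Suc i)))) {0..T}"
      proof (rule fundamental_theorem_of_calculus)
        fix t assume t: "t \<in> {0..T}"
        have "((\<lambda>t. \<phi> t \<bullet> e (Suc i)) has_real_derivative \<phi>' t \<bullet> e (Suc i)) (at t within {0..T})"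
          using bounded_linear.has_vector_derivative[OF bounded_linear_inner_left \<phi>'[OF t]]
          by (simp add: has_real_derivative_iff_has_vector_derivative)
        moreover have "(z i has_real_derivative - ((lam (Suc i))\<^sup>2 * c t * y i t)) (at t within {0..T})"
          using DERIV_subset[OF z_deriv[of t i], of "{0..T}"] t by (auto simp: c_def norm_tension)
        ultimately have "((\<lambda>t. z i t * (\<phi> t \<bullet> e (Suc i))) has_real_derivative
            - ((lam (Suc i))\<^sup>2 * c t * y i t) * (\<phi> t \<bullet> e (Suc i)) + (\<phi>' t \<bullet> e (Suc i)) * z i t)
            (at t within {0..T})" by (rule DERIV_mult[rotated])
        moreover have "?A t \<bullet> e (Suc i) = lam (Suc i) * (\<phi> t \<bullet> e (Suc i))"
          using \<phi>0 t by (intro inner_A_half) (simp add: C0_dom_half_def)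
        ultimately show "((\<lambda>t. z i t * (\<phi> t \<bullet> e (Suc i))) has_vector_derivative
            z i t * (\<phi>' t \<bullet> e (Suc i)) - c t * ((lam (Suc i) * y i t) * (?A t \<bullet> e (Suc i))))
            (at t within {0..T})"
          by (simp add: has_real_derivative_iff_has_vector_derivative power2_eq_square algebra_simps)
      qed (use T in simp)
      then show ?thesis by (simp add: ends)
    qed
    then have "((\<lambda>t. \<Sum>i<n. z i t * (\<phi>' t \<bullet> e (Suc i)) - c t * ((lam (Suc i) * y i t) * (?A t \<bullet> e (Suc i))))
        has_integral (\<Sum>i<n. 0)) {0..T}" by (intro has_integral_sum) auto
    then show ?thesis by (simp add: f_def sum_subtractf sum_distrib_left)
  qed
  have "(\<lambda>n. integral {0..T} (f n)) \<longlonglongrightarrow> integral {0..T} (\<lambda>t. velocity t \<bullet> \<phi>' t - c t * (tension t \<bullet> ?A t))"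
  proof (rule dominated_convergence(2))
    show "f n integrable_on {0..T}" for n using f_int by (rule has_integral_integrable)
    show "(\<lambda>t. norm (velocity t) * norm (\<phi>' t) + K * (norm (tension t) * norm (?A t))) integrable_on {0..T}"
      by (intro integrable_continuous_interval continuous_intros contv contw contA cont)
  next
    fix n t assume t: "t \<in> {0..T}"
    have 1: "\<bar>\<Sum>i<n. z i t * (\<phi>' t \<bullet> e (Suc i))\<bar> \<le> norm (velocity t) * norm (\<phi>' t)"
      unfolding velocity_def using t by (intro abs_inner_partial_sum_le summable_modes) simp
    have "\<bar>\<Sum>i<n. (lam (Suc i) * y i t) * (?A t \<bullet> e (Suc i))\<bar> \<le> norm (tension t) * norm (?A t)"
      unfolding tension_def using t by (intro abs_inner_partial_sum_le summable_modes) simp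
    then have 2: "\<bar>c t * (\<Sum>i<n. (lam (Suc i) * y i t) * (?A t \<bullet> e (Suc i)))\<bar>
        \<le> K * (norm (tension t) * norm (?A t))"
      unfolding abs_mult using c_bounds[of t] K_ge by (intro mult_mono) auto
    show "norm (f n t) \<le> norm (velocity t) * norm (\<phi>' t) + K * (norm (tension t) * norm (?A t))"
      unfolding f_def real_norm_def using 1 2 by linarith
  next
    fix t assume t: "t \<in> {0..T}"
    show "(\<lambda>n. f n t) \<longlonglongrightarrow> velocity t \<bullet> \<phi>' t - c t * (tension t \<bullet> ?A t)"
      unfolding f_def velocity_def tension_def using t
      by (intro tendsto_diff tendsto_mult tendsto_const inner_suminf_LIMSEQ summable_modes) simp_all
  qed
  moreover have "integral {0..T} (f n) = 0" for n using f_int by (rule integral_unique)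
  ultimately have "integral {0..T} (\<lambda>t. velocity t \<bullet> \<phi>' t - c t * (tension t \<bullet> ?A t)) = 0"
    using LIMSEQ_unique[OF _ tendsto_const[of 0]] by auto
  moreover have "integral {0..T} (\<lambda>t. velocity t \<bullet> \<phi>' t - c t * (tension t \<bullet> ?A t))
      = integral {0..T} (\<lambda>t. velocity t \<bullet> \<phi>' t) - integral {0..T} (\<lambda>t. c t * (tension t \<bullet> ?A t))"
    by (intro integral_diff integrable_continuous_interval continuous_intros contv contw contA cont contc)
  ultimately show ?thesis by (simp add: c_def)
qed

lemma global_weak_solution_solution: "global_weak_solution e lam m u0 u1 solution"
  unfolding global_weak_solution_def
proof (intro conjI allI impI)
  have deriv: "vector_derivative solution (at t within {0..}) = velocity t" if "0 \<le> t" for t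
    by (rule vector_derivative_halfline[OF solution_deriv[OF that] that])
  show "C0_dom_half e lam {0..} solution" by (rule solution_C0)
  show "C1_on {0..} solution"
    unfolding C1_on_def using solution_deriv continuous_velocity by (intro exI[of _ velocity]) auto
  show "solution 0 = u0" by (rule solution_0)
  show "vector_derivative solution (at 0 within {0..}) = u1" by (simp add: deriv velocity_0)
  fix T :: real and \<phi>
  assume T: "0 < T" and \<phi>: "C0_dom_half e lam {0..T} \<phi> \<and> C1_on {0..T} \<phi> \<and> \<phi> 0 = 0 \<and> \<phi> T = 0"
  then obtain \<phi>' where \<phi>': "\<And>t. t \<in> {0..T} \<Longrightarrow> (\<phi> has_vector_derivative \<phi>' t) (at t within {0..T})"
    and cont: "continuous_on {0..T} \<phi>'"
    unfolding C1_on_def by blast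
  have "vector_derivative \<phi> (at t within {0..T}) = \<phi>' t" if "t \<in> {0..T}" for t
    using vector_derivative_within_cbox[of 0 T t \<phi> "\<phi>' t"] T that \<phi>'[OF that] by simp
  then have "integral {0..T} (\<lambda>t. vector_derivative solution (at t within {0..}) \<bullet>
        vector_derivative \<phi> (at t within {0..T})) = integral {0..T} (\<lambda>t. velocity t \<bullet> \<phi>' t)"
    by (intro integral_cong) (simp add: deriv)
  also have "\<dots> = integral {0..T} (\<lambda>t. m ((norm (tension t))\<^sup>2) * (tension t \<bullet> A_half e lam (\<phi> t)))"
    by (rule weak_equation[OF T _ \<phi>' cont]) (use \<phi> in auto)
  also have "\<dots> = integral {0..T} (\<lambda>t. m ((norm (A_half e lam (solution t)))\<^sup>2) *
        (A_half e lam (solution t) \<bullet> A_half e lam (\<phi> t)))"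
    by (intro integral_cong) (simp add: A_half_solution)
  finally show "integral {0..T} (\<lambda>t. vector_derivative solution (at t within {0..}) \<bullet>
        vector_derivative \<phi> (at t within {0..T}))
      = integral {0..T} (\<lambda>t. m ((norm (A_half e lam (solution t)))\<^sup>2) *
        (A_half e lam (solution t) \<bullet> A_half e lam (\<phi> t)))" .
qed

end

section \<open>Lacunary data and the cut-off nonlinearity\<close>

lemma orthonormal_basis_eigenbasis:
  fixes e :: "nat \<Rightarrow> 'a::{real_inner, banach}"
  assumes "orthonormal_basis e"
  shows "orthonormal_eigenbasis e"
proof
  show "e (Suc i) \<bullet> e (Suc j) = (if i = j then 1 else 0)" for i j
    using assms by (simp add: orthonormal_basis_def)
  fix v assume v: "\<And>i. v \<bullet> e (Suc i) = 0"
  have "v \<bullet> e i = 0" if "1 \<le> i" for i using v[of "i - 1"] that by simp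
  then have "e ` {1..} \<subseteq> {x. v \<bullet> x = 0}" by auto
  then have "span (e ` {1..}) \<subseteq> {x. v \<bullet> x = 0}" by (rule span_minimal) (rule subspace_hyperplane)
  then have "closure (span (e ` {1..})) \<subseteq> {x. v \<bullet> x = 0}"
    by (rule closure_minimal) (rule closed_hyperplane)
  moreover have "closure (span (e ` {1..})) = UNIV" using assms by (simp only: orthonormal_basis_def)
  ultimately have "v \<in> {x. v \<bullet> x = 0}" by blast
  then show "v = 0" by simp
qed

lemma C1_on_lipschitz:
  fixes m :: "real \<Rightarrow> real"
  assumes "C1_on {0..} m"
  shows "\<exists>L\<ge>0. \<forall>\<sigma>\<in>{0..S}. \<forall>\<tau>\<in>{0..S}. \<bar>m \<sigma> - m \<tau>\<bar> \<le> L * \<bar>\<sigma> - \<tau>\<bar>"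
proof -
  obtain m' where m': "\<And>t. 0 \<le> t \<Longrightarrow> (m has_real_derivative m' t) (at t within {0..})"
    and cont: "continuous_on {0..} m'"
    using assms unfolding C1_on_def has_real_derivative_iff_has_vector_derivative by auto
  have "compact (m' ` {0..S})"
    by (intro compact_continuous_image continuous_on_subset[OF cont]) auto
  then obtain L where L: "0 < L" "\<And>t. t \<in> {0..S} \<Longrightarrow> \<bar>m' t\<bar> \<le> L"
    using compact_imp_bounded bounded_pos by (metis imageI real_norm_def)
  have "\<bar>m \<sigma> - m \<tau>\<bar> \<le> L * \<bar>\<sigma> - \<tau>\<bar>" if "\<sigma> \<in> {0..S}" "\<tau> \<in> {0..S}" for \<sigma> \<tau>
  proof -
    have "norm (m \<sigma> - m \<tau>) \<le> L * norm (\<sigma> - \<tau>)"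
    proof (rule field_differentiable_bound[of "{0..S}"])
      show "(m has_real_derivative m' t) (at t within {0..S})" if "t \<in> {0..S}" for t
        by (rule DERIV_subset[OF m']) (use that in auto)
    qed (use that L in auto)
    then show ?thesis by simp
  qed
  then show ?thesis using L(1) less_imp_le by blast
qed

text \<open>Freezing \<open>m\<close> beyond \<open>S\<close> turns local Lipschitz continuity into a global one and makes \<open>m\<close> bounded,
  while the positive lower bound is kept.\<close>

lemma kirchhoff_coefficients_cutoff:
  assumes mono: "mono_on {1..} lam" and pos: "\<And>i. i \<ge> 1 \<Longrightarrow> lam i > 0"
    and m: "C1_on {0..} m" and \<mu>: "0 < \<mu>" "\<And>\<sigma>. 0 \<le> \<sigma> \<Longrightarrow> \<mu> \<le> m \<sigma>" and S: "0 \<le> S"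
  shows "\<exists>K L. kirchhoff_coefficients (\<lambda>i. lam (Suc i)) (\<lambda>\<sigma>. m (min \<sigma> S)) \<mu> K L"
proof -
  obtain L where L: "0 \<le> L" "\<forall>\<sigma>\<in>{0..S}. \<forall>\<tau>\<in>{0..S}. \<bar>m \<sigma> - m \<tau>\<bar> \<le> L * \<bar>\<sigma> - \<tau>\<bar>"
    using C1_on_lipschitz[OF m] by blast
  have lip: "\<bar>m (min \<sigma> S) - m (min \<tau> S)\<bar> \<le> L * \<bar>\<sigma> - \<tau>\<bar>" if "0 \<le> \<sigma>" "0 \<le> \<tau>" for \<sigma> \<tau>
  proof -
    have "\<bar>m (min \<sigma> S) - m (min \<tau> S)\<bar> \<le> L * \<bar>min \<sigma> S - min \<tau> S\<bar>" using L(2) S that by simp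
    also have "\<dots> \<le> L * \<bar>\<sigma> - \<tau>\<bar>" using L(1) by (intro mult_left_mono) auto
    finally show ?thesis .
  qed
  have bound: "m (min \<sigma> S) \<le> max 1 (m 0 + L * S)" if "0 \<le> \<sigma>" for \<sigma>
  proof -
    have "\<bar>m (min \<sigma> S) - m 0\<bar> \<le> L * \<bar>min \<sigma> S - 0\<bar>"
      using S that by (intro L(2)[rule_format]) auto
    also have "\<dots> \<le> L * S" using L(1) S that by (intro mult_left_mono) auto
    finally show ?thesis by linarith
  qed
  have "kirchhoff_coefficients (\<lambda>i. lam (Suc i)) (\<lambda>\<sigma>. m (min \<sigma> S)) \<mu> (max 1 (m 0 + L * S)) L"
  proof
    show "mono (\<lambda>i. lam (Suc i))"
      using mono by (auto simp: mono_def monotone_on_def)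
  qed (use pos \<mu> S L lip bound in auto)
  then show ?thesis by blast
qed

text \<open>The mode with number \<open>i\<close> has frequency \<open>lam (Suc i)\<close>, so the modes below \<open>k\<close> have frequencies up
  to \<open>lam k\<close>, the one in the condition on the data.  It is written \<open>lam (Suc (k - 1))\<close>, the
  frequency of the mode \<open>k - 1\<close>.\<close>

lemma lacunary_modes:
  fixes e :: "nat \<Rightarrow> 'a::{real_inner, banach}"
  assumes e: "orthonormal_eigenbasis e" and SG: "(u0, u1) \<in> SG e lam"
    and g_def: "g = (\<lambda>i. (lam (Suc i) * (u0 \<bullet> e (Suc i)))\<^sup>2 + (u1 \<bullet> e (Suc i))\<^sup>2)"
  shows "summable g"
    and "infinite {k. 1 \<le> k \<and> (\<forall>n. (\<Sum>i=k..<n. g i) * ((real k)\<^sup>2 * exp (real k * lam (Suc (k - 1)))) \<le> 1)}"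
proof -
  interpret orthonormal_eigenbasis e lam by (rule e)
  have "u0 \<in> dom_half e lam" using SG by (simp add: SG_def)
  then show sg: "summable g" unfolding g_def dom_half_iff by (intro summable_add summable_bessel)
  have g0: "0 \<le> g i" for i by (simp add: g_def)
  have rem: "(\<Sum>i=k..<n. g i) \<le> lacunary_remainder e lam u0 u1 k" for k n
  proof -
    have "(\<Sum>i=k..<n. g i) \<le> (\<Sum>j<n. g (j + k))"
    proof (cases "k \<le> n")
      case True
      have "(\<Sum>i=k..<n. g i) = (\<Sum>j<n - k. g (j + k))"
        using sum.shift_bounds_nat_ivl[of g 0 k "n - k"] True by (simp add: lessThan_atLeast0)
      also have "\<dots> \<le> (\<Sum>j<n. g (j + k))" using g0 by (intro sum_mono2) auto
      finally show ?thesis .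
    qed (simp add: sum_nonneg g0)
    also have "\<dots> \<le> (\<Sum>j. g (j + k))"
      using sg g0 by (intro sum_le_suminf) (auto simp: summable_iff_shift)
    also have "\<dots> = lacunary_remainder e lam u0 u1 k"
      unfolding lacunary_remainder_def g_def
      by (simp add: power_mult_distrib add.commute)
    finally show ?thesis .
  qed
  have "infinite {k. k \<ge> 1 \<and> lacunary_remainder e lam u0 u1 k * ((real k)\<^sup>2 * exp (real k * lam k)) \<le> 1}"
    using SG by (simp add: SG_def)
  then show "infinite {k. 1 \<le> k \<and> (\<forall>n. (\<Sum>i=k..<n. g i)
      * ((real k)\<^sup>2 * exp (real k * lam (Suc (k - 1)))) \<le> 1)}"
  proof (rule infinite_super[rotated])
    have "(\<Sum>i=k..<n. g i) * ((real k)\<^sup>2 * exp (real k * lam k))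
        \<le> lacunary_remainder e lam u0 u1 k * ((real k)\<^sup>2 * exp (real k * lam k))" for k n
      using rem by (intro mult_right_mono) auto
    then show "{k. k \<ge> 1 \<and> lacunary_remainder e lam u0 u1 k * ((real k)\<^sup>2 * exp (real k * lam k)) \<le> 1}
        \<subseteq> {k. 1 \<le> k \<and> (\<forall>n. (\<Sum>i=k..<n. g i) * ((real k)\<^sup>2 * exp (real k * lam (Suc (k - 1)))) \<le> 1)}"
      using order_trans by auto blast
  qed
qed

lemma mode_solution_exists:
  fixes e :: "nat \<Rightarrow> 'a::{real_inner, banach}"
  assumes e: "orthonormal_eigenbasis e" and SG: "(u0, u1) \<in> SG e lam"
    and coeffs: "kirchhoff_coefficients (\<lambda>i. lam (Suc i)) m \<mu> K L"
    and S: "0 \<le> S" and cutoff: "\<And>\<sigma>. S \<le> \<sigma> \<Longrightarrow> m \<sigma> = m S"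
  shows "\<exists>y z. mode_solution lam m \<mu> K L y z e u0 u1"
proof -
  interpret orthonormal_eigenbasis e lam by (rule e)
  interpret kirchhoff_coefficients "\<lambda>i. lam (Suc i)" m \<mu> K L by (rule coeffs)
  interpret kirchhoff_hilbert "\<lambda>i. lam (Suc i)" m \<mu> K L "\<lambda>i. e (Suc i)"
    by (intro kirchhoff_hilbert.intro coeffs orthonormal_sequence_axioms)
  define g where "g = (\<lambda>i. (lam (Suc i) * (u0 \<bullet> e (Suc i)))\<^sup>2 + (u1 \<bullet> e (Suc i))\<^sup>2)"
  note lac = lacunary_modes[OF e SG g_def]
  have "\<exists>y z. galerkin (\<lambda>i. lam (Suc i)) m \<mu> K L N y z
      \<and> (\<forall>i<N. y i 0 = u0 \<bullet> e (Suc i) \<and> z i 0 = u1 \<bullet> e (Suc i))" for N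
  proof (rule galerkin_exists)
    show "0 \<le> sqrt S" using S by simp
    show "m \<sigma> = m ((sqrt S)\<^sup>2)" if "(sqrt S)\<^sup>2 \<le> \<sigma>" for \<sigma>
      using cutoff[of \<sigma>] that S by simp
  qed
  then obtain Y Z where gal: "\<And>N. galerkin (\<lambda>i. lam (Suc i)) m \<mu> K L N (Y N) (Z N)"
    and init: "\<And>N i. i < N \<Longrightarrow> Y N i 0 = u0 \<bullet> e (Suc i)" "\<And>N i. i < N \<Longrightarrow> Z N i 0 = u1 \<bullet> e (Suc i)"
    by metis
  have "(\<Sum>i<n. g i) \<le> suminf g" for n
    using lac(1) by (intro sum_le_suminf) (auto simp: g_def)
  from global_modes_exist[OF gal init this[unfolded g_def] lac(2)[unfolded g_def]]
  obtain y z where yz: "global_modes (\<lambda>i. lam (Suc i)) m \<mu> K L y z"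
    and y0: "\<And>i. y i 0 = u0 \<bullet> e (Suc i)" and z0: "\<And>i. z i 0 = u1 \<bullet> e (Suc i)" by blast
  interpret global_modes "\<lambda>i. lam (Suc i)" m \<mu> K L y z by (rule yz)
  have "mode_solution lam m \<mu> K L y z e u0 u1" by unfold_locales (simp_all add: y0 z0)
  then show ?thesis by blast
qed

lemma global_weak_solution_cong:
  assumes "global_weak_solution e lam m u0 u1 u"
    and "\<And>t. 0 \<le> t \<Longrightarrow> m ((norm (A_half e lam (u t)))\<^sup>2) = m' ((norm (A_half e lam (u t)))\<^sup>2)"
  shows "global_weak_solution e lam m' u0 u1 u"
proof -
  have "integral {0..T} (\<lambda>t. m' ((norm (A_half e lam (u t)))\<^sup>2) * f t)
      = integral {0..T} (\<lambda>t. m ((norm (A_half e lam (u t)))\<^sup>2) * f t)" for T f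
    by (rule integral_cong) (simp add: assms(2))
  then show ?thesis using assms(1) unfolding global_weak_solution_def by simp
qed

theorem theorem2p4:
  fixes D :: "'a::{real_inner, banach} set"
    and A :: "'a \<Rightarrow> 'a"
    and e :: "nat \<Rightarrow> 'a"
    and lam :: "nat \<Rightarrow> real"
    and m :: "real \<Rightarrow> real"
    and u0 u1 :: 'a
  assumes "self_adjoint_operator D A"
    and "orthonormal_basis e"
    and "mono_on {1..} lam"
    and "\<And>i. i \<ge> 1 \<Longrightarrow> lam i > 0"
    and "filterlim lam at_top sequentially"
    and "\<And>i. i \<ge> 1 \<Longrightarrow> e i \<in> D \<and> A (e i) = (lam i)\<^sup>2 *\<^sub>R e i"
    and "(u0, u1) \<in> SG e lam"
    and "\<And>\<sigma>. \<sigma> \<ge> 0 \<Longrightarrow> m \<sigma> \<ge> 0"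
    and "C1_on {0..} m"
    and "(INF \<sigma>\<in>{0..}. m \<sigma>) > 0"
  shows "\<exists>u. global_weak_solution e lam m u0 u1 u \<and>
           (\<forall>t\<ge>0. (norm (vector_derivative u (at t within {0..})))\<^sup>2
                    + integral {0..(norm (A_half e lam (u t)))\<^sup>2} m
                  = (norm u1)\<^sup>2 + integral {0..(norm (A_half e lam u0))\<^sup>2} m)"
proof -
  define \<mu> where "\<mu> = (INF \<sigma>\<in>{0..}. m \<sigma>)"
  have \<mu>_le: "\<mu> \<le> m \<sigma>" if "0 \<le> \<sigma>" for \<sigma>
    using assms(8) that unfolding \<mu>_def by (auto intro!: cINF_lower bdd_belowI2[of _ 0])
  have \<mu>: "0 < \<mu>" using assms(10) by (simp add: \<mu>_def)
  \<comment> \<open>Along the solution the energy bounds the argument of \<open>m\<close> by \<open>E0 / \<mu>\<close>; with \<open>Q0 \<le> S\<close>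
    as well, the cut-off does not change the initial energy.\<close>
  define Q0 where "Q0 = (norm (A_half e lam u0))\<^sup>2"
  define E0 where "E0 = (norm u1)\<^sup>2 + integral {0..Q0} m"
  define S where "S = max Q0 (E0 / \<mu>)"
  have S: "0 \<le> S" "Q0 \<le> S" by (simp_all add: S_def Q0_def le_max_iff_disj)
  have "E0 / \<mu> \<le> S" by (simp add: S_def)
  then have E0_le: "E0 \<le> \<mu> * S" using \<mu> by (simp add: field_simps)
  define mS where "mS = (\<lambda>\<sigma>. m (min \<sigma> S))"
  have mS: "mS \<sigma> = m \<sigma>" if "\<sigma> \<le> S" for \<sigma> using that by (simp add: mS_def)
  have int_mS: "integral {0..\<sigma>} mS = integral {0..\<sigma>} m" if "\<sigma> \<le> S" for \<sigma>
    by (rule integral_cong) (use that in \<open>simp add: mS\<close>)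
  have e: "orthonormal_eigenbasis e" by (rule orthonormal_basis_eigenbasis[OF assms(2)])
  obtain K L where coeffs: "kirchhoff_coefficients (\<lambda>i. lam (Suc i)) mS \<mu> K L"
    using kirchhoff_coefficients_cutoff[OF assms(3,4,9) \<mu> \<mu>_le S(1)] unfolding mS_def by blast
  have "mS \<sigma> = mS S" if "S \<le> \<sigma>" for \<sigma> using that by (simp add: mS_def)
  from mode_solution_exists[OF e assms(7) coeffs S(1) this]
  obtain y z where "mode_solution lam mS \<mu> K L y z e u0 u1" by blast
  then interpret mode_solution lam mS \<mu> K L y z e u0 u1 .
  have M: "M \<sigma> = integral {0..\<sigma>} m" if "\<sigma> \<le> S" for \<sigma>
    using int_mS[OF that] by (simp add: M_def)
  have energy_E0: "(norm (velocity t))\<^sup>2 + M ((norm (tension t))\<^sup>2) = E0" if "0 \<le> t" for t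
    using energy_equality[OF that] M[OF S(2)] by (simp add: E0_def Q0_def)
  have tension_le: "(norm (tension t))\<^sup>2 \<le> S" if "0 \<le> t" for t
  proof -
    have "\<mu> * (norm (tension t))\<^sup>2 \<le> M ((norm (tension t))\<^sup>2)"
      using M_diff_bounds(1)[of 0 "(norm (tension t))\<^sup>2"] by simp
    also have "\<dots> \<le> E0" using energy_E0[OF that] zero_le_power2[of "norm (velocity t)"] by linarith
    also have "\<dots> \<le> \<mu> * S" by (rule E0_le)
    finally show ?thesis using \<mu> by simp
  qed
  have "global_weak_solution e lam m u0 u1 solution"
    by (rule global_weak_solution_cong[OF global_weak_solution_solution])
       (simp add: A_half_solution tension_le mS)
  moreover have "(norm (vector_derivative solution (at t within {0..})))\<^sup>2
                    + integral {0..(norm (A_half e lam (solution t)))\<^sup>2} m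
                  = (norm u1)\<^sup>2 + integral {0..(norm (A_half e lam u0))\<^sup>2} m" if "0 \<le> t" for t
    using energy_E0[OF that] M[OF tension_le[OF that]] A_half_solution[OF that]
      vector_derivative_halfline[OF solution_deriv[OF that] that]
    by (simp add: E0_def Q0_def)
  ultimately show ?thesis by blast
qed

end
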